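(* Let $(K,v)$ be a henselian valued field such that the residue field $Kv$ is PAC and not separably closed. Then $v$ is $\emptyset$-definable.
   Context: A field $F$ is PAC (pseudo-algebraically closed) if every absolutely irreducible variety defined over $F$ has an $F$-rational point. A valuation $v$ on $K$ is $\emptyset$-definable if there is a parameter-free first-order formula in the language of rings defining its valuation ring $\mathcal{O}_v$ in $K$. *)

theory Defs
  imports
    "HOL-Algebra.Algebraic_Closure_Type"
    "HOL-Library.Poly_Mapping"
begin

section \<open>Valued fields\<close>

text \<open>
  A valuation with values in the ordered abelian group \<open>'g\<close> is given by its values on the
  nonzero elements; the value at \<open>0\<close> stands for \<open>\<infinity>\<close>, so \<open>v 0\<close> is never used. Surjectivity onto
  \<open>'g\<close> is not required (the value group is the image of the nonzero elements), and the trivial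
  valuation is allowed.
\<close>

definition valuation :: "('a::field \<Rightarrow> 'g::linordered_ab_group_add) \<Rightarrow> bool" where
  "valuation v \<longleftrightarrow>
     (\<forall>x y. x \<noteq> 0 \<longrightarrow> y \<noteq> 0 \<longrightarrow> v (x * y) = v x + v y) \<and>
     (\<forall>x y. x \<noteq> 0 \<longrightarrow> y \<noteq> 0 \<longrightarrow> x + y \<noteq> 0 \<longrightarrow> min (v x) (v y) \<le> v (x + y))"

definition valuation_ring :: "('a::field \<Rightarrow> 'g::linordered_ab_group_add) \<Rightarrow> 'a set" where
  "valuation_ring v = {x. x = 0 \<or> 0 \<le> v x}"

definition valuation_ideal :: "('a::field \<Rightarrow> 'g::linordered_ab_group_add) \<Rightarrow> 'a set" where
  "valuation_ideal v = {x. x = 0 \<or> 0 < v x}"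

text \<open>
  Henselianity in the form of Hensel's lemma: a simple zero of the reduction of a polynomial over
  the valuation ring lifts to a zero in the valuation ring.
\<close>

definition henselian :: "('a::field \<Rightarrow> 'g::linordered_ab_group_add) \<Rightarrow> bool" where
  "henselian v \<longleftrightarrow>
     (\<forall>(p :: 'a poly) a.
        (\<forall>i. poly.coeff p i \<in> valuation_ring v) \<longrightarrow> a \<in> valuation_ring v \<longrightarrow>
        poly p a \<in> valuation_ideal v \<longrightarrow> poly (pderiv p) a \<notin> valuation_ideal v \<longrightarrow>
        (\<exists>b\<in>valuation_ring v. poly p b = 0 \<and> b - a \<in> valuation_ideal v))"

text \<open>
  The residue field is represented by a type \<open>'k\<close> together with a residue map, that is, a
  surjective ring homomorphism from the valuation ring to \<open>'k\<close> whose kernel is the valuation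
  ideal. The values of \<open>r\<close> outside the valuation ring are irrelevant. The theorem
  \<open>residue_map_iff_quotient\<close> below states that \<open>'k\<close> admits such a map if and only if it is
  isomorphic to the quotient of the valuation ring by the valuation ideal.
\<close>

definition residue_map ::
    "('a::field \<Rightarrow> 'g::linordered_ab_group_add) \<Rightarrow> ('a \<Rightarrow> 'k::field) \<Rightarrow> bool" where
  "residue_map v r \<longleftrightarrow>
     r 1 = 1 \<and>
     (\<forall>x\<in>valuation_ring v. \<forall>y\<in>valuation_ring v. r (x + y) = r x + r y \<and> r (x * y) = r x * r y) \<and>
     r ` valuation_ring v = UNIV \<and>
     (\<forall>x\<in>valuation_ring v. r x = 0 \<longleftrightarrow> x \<in> valuation_ideal v)"

definition valuation_ring_structure ::
    "('a::field \<Rightarrow> 'g::linordered_ab_group_add) \<Rightarrow> 'a ring" where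
  "valuation_ring_structure v = ring_of_type_algebra\<lparr>carrier := valuation_ring v\<rparr>"

lemma valuation_one:
  assumes "valuation v"
  shows "v 1 = 0"
proof -
  have "v (1 * 1) = v 1 + v 1"
    using assms unfolding valuation_def using one_neq_zero by blast
  then show ?thesis by simp
qed

lemma valuation_minus:
  assumes "valuation v" "x \<noteq> 0"
  shows "v (- x) = v x"
proof -
  have "v ((-1) * (-1)) = v (-1) + v (-1)"
    using assms(1) unfolding valuation_def by (metis neg_equal_0_iff_equal one_neq_zero)
  then have "v (-1) + v (-1) = 0"
    using valuation_one[OF assms(1)] by simp
  then have "v (-1) = 0"
    by (simp add: double_zero)
  moreover have "v ((-1) * x) = v (-1) + v x"
    using assms unfolding valuation_def by (metis neg_equal_0_iff_equal one_neq_zero)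
  ultimately show ?thesis by simp
qed

lemma valuation_ring_closed:
  assumes "valuation v"
  shows "0 \<in> valuation_ring v" "1 \<in> valuation_ring v"
    and "x \<in> valuation_ring v \<Longrightarrow> - x \<in> valuation_ring v"
    and "x \<in> valuation_ring v \<Longrightarrow> y \<in> valuation_ring v \<Longrightarrow> x + y \<in> valuation_ring v"
    and "x \<in> valuation_ring v \<Longrightarrow> y \<in> valuation_ring v \<Longrightarrow> x * y \<in> valuation_ring v"
proof -
  show "0 \<in> valuation_ring v" "1 \<in> valuation_ring v"
    using valuation_one[OF assms] by (auto simp: valuation_ring_def)
  show "- x \<in> valuation_ring v" if "x \<in> valuation_ring v"
    using that valuation_minus[OF assms, of x] by (cases "x = 0") (auto simp: valuation_ring_def)
  show "x + y \<in> valuation_ring v" if xy: "x \<in> valuation_ring v" "y \<in> valuation_ring v"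
  proof (cases "x = 0 \<or> y = 0 \<or> x + y = 0")
    case False
    then have "min (v x) (v y) \<le> v (x + y)"
      using assms unfolding valuation_def by blast
    moreover have "0 \<le> min (v x) (v y)"
      using xy False by (auto simp: valuation_ring_def)
    ultimately show ?thesis
      unfolding valuation_ring_def using order_trans by blast
  qed (use xy in \<open>auto simp: valuation_ring_def\<close>)
  show "x * y \<in> valuation_ring v" if xy: "x \<in> valuation_ring v" "y \<in> valuation_ring v"
  proof (cases "x = 0 \<or> y = 0")
    case False
    then have "v (x * y) = v x + v y"
      using assms unfolding valuation_def by blast
    then show ?thesis
      using xy False by (auto simp: valuation_ring_def)
  qed (auto simp: valuation_ring_def)
qed

lemma valuation_ideal_closed:
  assumes "valuation v"
  shows "0 \<in> valuation_ideal v"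
    and "x \<in> valuation_ideal v \<Longrightarrow> x \<in> valuation_ring v"
    and "x \<in> valuation_ideal v \<Longrightarrow> - x \<in> valuation_ideal v"
    and "x \<in> valuation_ideal v \<Longrightarrow> y \<in> valuation_ideal v \<Longrightarrow> x + y \<in> valuation_ideal v"
    and "x \<in> valuation_ring v \<Longrightarrow> y \<in> valuation_ideal v \<Longrightarrow> x * y \<in> valuation_ideal v"
proof -
  show "0 \<in> valuation_ideal v"
    by (auto simp: valuation_ideal_def)
  show "x \<in> valuation_ring v" if "x \<in> valuation_ideal v"
    using that by (auto simp: valuation_ideal_def valuation_ring_def)
  show "- x \<in> valuation_ideal v" if "x \<in> valuation_ideal v"
    using that valuation_minus[OF assms, of x] by (cases "x = 0") (auto simp: valuation_ideal_def)
  show "x + y \<in> valuation_ideal v" if xy: "x \<in> valuation_ideal v" "y \<in> valuation_ideal v"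
  proof (cases "x = 0 \<or> y = 0 \<or> x + y = 0")
    case False
    then have "min (v x) (v y) \<le> v (x + y)"
      using assms unfolding valuation_def by blast
    moreover have "0 < min (v x) (v y)"
      using xy False by (auto simp: valuation_ideal_def)
    ultimately show ?thesis
      unfolding valuation_ideal_def using less_le_trans by blast
  qed (use xy in \<open>auto simp: valuation_ideal_def\<close>)
  show "x * y \<in> valuation_ideal v" if xy: "x \<in> valuation_ring v" "y \<in> valuation_ideal v"
  proof (cases "x = 0 \<or> y = 0")
    case False
    then have "v (x * y) = v x + v y"
      using assms unfolding valuation_def by blast
    then show ?thesis
      using xy False by (auto simp: valuation_ring_def valuation_ideal_def add_nonneg_pos)
  qed (auto simp: valuation_ideal_def)
qed

lemma valuation_ring_structure_simps [simp]:
  "carrier (valuation_ring_structure v) = valuation_ring v"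
  "x \<otimes>\<^bsub>valuation_ring_structure v\<^esub> y = x * y"
  "x \<oplus>\<^bsub>valuation_ring_structure v\<^esub> y = x + y"
  "\<one>\<^bsub>valuation_ring_structure v\<^esub> = 1"
  "\<zero>\<^bsub>valuation_ring_structure v\<^esub> = 0"
  by (simp_all add: valuation_ring_structure_def ring_of_type_algebra_def)

lemma ring_of_type_algebra_simps [simp]:
  "carrier (ring_of_type_algebra :: 'k::field ring) = UNIV"
  "x \<otimes>\<^bsub>ring_of_type_algebra\<^esub> y = x * (y :: 'k)"
  "x \<oplus>\<^bsub>ring_of_type_algebra\<^esub> y = x + (y :: 'k)"
  "\<one>\<^bsub>ring_of_type_algebra\<^esub> = (1 :: 'k)"
  "\<zero>\<^bsub>ring_of_type_algebra\<^esub> = (0 :: 'k)"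
  by (simp_all add: ring_of_type_algebra_def)

lemma cring_valuation_ring_structure:
  assumes "valuation v"
  shows "cring (valuation_ring_structure v)"
proof (rule cringI)
  note closed = valuation_ring_closed[OF assms]
  show "abelian_group (valuation_ring_structure v)"
  proof (rule abelian_groupI)
    fix x assume "x \<in> carrier (valuation_ring_structure v)"
    then show "\<exists>y\<in>carrier (valuation_ring_structure v).
        y \<oplus>\<^bsub>valuation_ring_structure v\<^esub> x = \<zero>\<^bsub>valuation_ring_structure v\<^esub>"
      using closed(3) by (auto intro!: bexI[of _ "- x"])
  qed (use closed in \<open>auto simp: algebra_simps\<close>)
  show "comm_monoid (valuation_ring_structure v)"
    by (rule comm_monoidI) (use closed in \<open>auto simp: algebra_simps\<close>)
qed (auto simp: algebra_simps)

lemma ideal_valuation_ideal: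
  assumes "valuation v"
  shows "ideal (valuation_ideal v) (valuation_ring_structure v)"
proof -
  interpret R: cring "valuation_ring_structure v"
    by (rule cring_valuation_ring_structure[OF assms])
  note closed = valuation_ideal_closed[OF assms]
  have minus: "\<ominus>\<^bsub>valuation_ring_structure v\<^esub> x = - x" if "x \<in> valuation_ring v" for x
    by (rule R.minus_equality) (use that valuation_ring_closed(3)[OF assms] in auto)
  show ?thesis
  proof (rule idealI)
    show "ring (valuation_ring_structure v)"
      by (rule R.ring_axioms)
    show "subgroup (valuation_ideal v) (add_monoid (valuation_ring_structure v))"
    proof (rule R.add.subgroupI)
      fix x assume x: "x \<in> valuation_ideal v"
      then show "\<ominus>\<^bsub>valuation_ring_structure v\<^esub> x \<in> valuation_ideal v"
        using closed(2,3) by (simp add: minus)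
    qed (use closed in auto)
    fix a x
    assume "a \<in> valuation_ideal v" "x \<in> carrier (valuation_ring_structure v)"
    then show "x \<otimes>\<^bsub>valuation_ring_structure v\<^esub> a \<in> valuation_ideal v"
      and "a \<otimes>\<^bsub>valuation_ring_structure v\<^esub> x \<in> valuation_ideal v"
      using closed(5)[of x a] by (simp_all add: mult.commute)
  qed
qed

theorem residue_map_iff_quotient:
  fixes v :: "'a::field \<Rightarrow> 'g::linordered_ab_group_add"
  assumes "valuation v"
  shows "(\<exists>r :: 'a \<Rightarrow> 'k::field. residue_map v r) \<longleftrightarrow>
         valuation_ring_structure v Quot valuation_ideal v \<simeq> (ring_of_type_algebra :: 'k ring)"
    (is "_ \<longleftrightarrow> ?R Quot ?m \<simeq> ?S")
proof
  interpret R: cring ?R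
    by (rule cring_valuation_ring_structure[OF assms])
  interpret I: ideal ?m ?R
    by (rule ideal_valuation_ideal[OF assms])
  have S: "ring ?S"
    by (rule ring_from_type_algebra)
  {
    assume "\<exists>r :: 'a \<Rightarrow> 'k. residue_map v r"
    then obtain r :: "'a \<Rightarrow> 'k" where r: "residue_map v r" by blast
    then have one: "r 1 = 1" and surj: "r ` valuation_ring v = UNIV"
      by (simp_all add: residue_map_def)
    have add: "r (x + y) = r x + r y" and mult: "r (x * y) = r x * r y"
      if "x \<in> valuation_ring v" "y \<in> valuation_ring v" for x y
      using that r by (simp_all add: residue_map_def)
    have zero: "r x = 0 \<longleftrightarrow> x \<in> ?m" if "x \<in> valuation_ring v" for x
      using that r by (simp add: residue_map_def)
    have "ring_hom_ring ?R ?S r"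
      by (rule ring_hom_ringI[OF R.ring_axioms S]) (simp_all add: one add mult)
    then interpret h: ring_hom_ring ?R ?S r .
    have "r ` carrier ?R = carrier ?S"
      using surj by simp
    then have "?R Quot (a_kernel ?R ?S r) \<simeq> ?S"
      by (rule h.FactRing_iso)
    moreover have "a_kernel ?R ?S r = {x \<in> valuation_ring v. r x = 0}"
      by (simp only: a_kernel_def' valuation_ring_structure_simps ring_of_type_algebra_simps)
    moreover have "{x \<in> valuation_ring v. r x = 0} = ?m"
      using zero valuation_ideal_closed(2)[OF assms] by blast
    ultimately show "?R Quot ?m \<simeq> ?S"
      by simp
  }
  {
    assume "?R Quot ?m \<simeq> ?S"
    then obtain h where h: "h \<in> ring_iso (?R Quot ?m) ?S"
      by (auto simp: is_ring_iso_def)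
    define r :: "'a \<Rightarrow> 'k" where "r = h \<circ> (+>\<^bsub>?R\<^esub>) ?m"
    have hom: "r \<in> ring_hom ?R ?S"
      unfolding r_def using h I.rcos_ring_hom by (auto simp: ring_iso_def intro: ring_hom_trans)
    have surj: "r ` valuation_ring v = UNIV"
    proof -
      have "(+>\<^bsub>?R\<^esub>) ?m ` valuation_ring v = carrier (?R Quot ?m)"
        by (auto simp: FactRing_def A_RCOSETS_def')
      moreover have "h ` carrier (?R Quot ?m) = UNIV"
        using h by (auto simp: ring_iso_def bij_betw_def)
      ultimately show ?thesis
        by (simp only: r_def image_comp[symmetric])
    qed
    have zero: "r x = 0 \<longleftrightarrow> x \<in> ?m" if x: "x \<in> valuation_ring v" for x
    proof -
      interpret Q: ring "?R Quot ?m"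
        by (rule I.quotient_is_ring)
      have "h \<zero>\<^bsub>?R Quot ?m\<^esub> = 0"
        using ring_hom_zero[of h "?R Quot ?m" ?S] h S Q.ring_axioms by (auto simp: ring_iso_def)
      moreover have "inj_on h (carrier (?R Quot ?m))"
        using h by (auto simp: ring_iso_def bij_betw_def)
      moreover have "?m +>\<^bsub>?R\<^esub> x \<in> carrier (?R Quot ?m)"
        using x by (auto simp: FactRing_def A_RCOSETS_def')
      ultimately have "r x = 0 \<longleftrightarrow> ?m +>\<^bsub>?R\<^esub> x = \<zero>\<^bsub>?R Quot ?m\<^esub>"
        unfolding r_def comp_apply using inj_on_eq_iff[OF _ _ Q.zero_closed, of h] by simp
      also have "\<dots> \<longleftrightarrow> ?m +>\<^bsub>?R\<^esub> x = ?m"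
        by (simp add: FactRing_def)
      also have "\<dots> \<longleftrightarrow> x \<in> ?m"
        using x I.a_rcos_const[of x] I.a_rcos_self[of x] by (metis valuation_ring_structure_simps(1))
      finally show ?thesis .
    qed
    have "residue_map v r"
      unfolding residue_map_def
      using surj zero ring_hom_add[OF hom] ring_hom_mult[OF hom] ring_hom_one[OF hom] by simp
    then show "\<exists>r :: 'a \<Rightarrow> 'k. residue_map v r"
      by blast
  }
qed


section \<open>Separably closed fields\<close>

text \<open>
  A polynomial is separable if it has no multiple roots in an algebraic closure; \<open>rsquarefree\<close>
  speaks about roots, so it has to be applied after passing to the closure.
\<close>

definition separable_poly :: "'k::field poly \<Rightarrow> bool" where
  "separable_poly p \<longleftrightarrow> rsquarefree (map_poly to_ac p)"

definition separable_closure :: "'k::field alg_closure set" where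
  "separable_closure =
     {x. \<exists>p :: 'k poly. Factorial_Ring.irreducible p \<and> separable_poly p \<and>
                        poly (map_poly to_ac p) x = 0}"

definition separably_closed :: "'k::field itself \<Rightarrow> bool" where
  "separably_closed (_ :: 'k itself) \<longleftrightarrow> (separable_closure :: 'k alg_closure set) = range to_ac"


section \<open>Affine varieties and pseudo-algebraically closed fields\<close>

text \<open>
  Polynomials in the variables $X_0, X_1, \ldots$: exponent vectors of type \<open>nat \<Rightarrow>\<^sub>0 nat\<close>
  are mapped to their coefficients.
\<close>

type_synonym 'b mpoly = "(nat \<Rightarrow>\<^sub>0 nat) \<Rightarrow>\<^sub>0 'b"

definition mpolys :: "nat \<Rightarrow> 'b::zero mpoly set" where
  "mpolys n = {p. \<forall>m\<in>Poly_Mapping.keys p. Poly_Mapping.keys m \<subseteq> {..<n}}"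

definition mpoly_eval :: "'b::comm_ring_1 mpoly \<Rightarrow> (nat \<Rightarrow> 'b) \<Rightarrow> 'b" where
  "mpoly_eval p x =
     (\<Sum>m\<in>Poly_Mapping.keys p.
        Poly_Mapping.lookup p m * (\<Prod>i\<in>Poly_Mapping.keys m. x i ^ Poly_Mapping.lookup m i))"

definition affine_space :: "nat \<Rightarrow> (nat \<Rightarrow> 'b) set" where
  "affine_space n = ({..<n} \<rightarrow>\<^sub>E UNIV)"

definition zero_locus :: "nat \<Rightarrow> 'b::comm_ring_1 mpoly set \<Rightarrow> (nat \<Rightarrow> 'b) set" where
  "zero_locus n P = {x \<in> affine_space n. \<forall>p\<in>P. mpoly_eval p x = 0}"

definition vanishing_ideal :: "nat \<Rightarrow> (nat \<Rightarrow> 'b::comm_ring_1) set \<Rightarrow> 'b mpoly set" where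
  "vanishing_ideal n V = {p \<in> mpolys n. \<forall>x\<in>V. mpoly_eval p x = 0}"

definition algebraic_set :: "nat \<Rightarrow> (nat \<Rightarrow> 'b::comm_ring_1) set \<Rightarrow> bool" where
  "algebraic_set n V \<longleftrightarrow> (\<exists>P\<subseteq>mpolys n. V = zero_locus n P)"

definition irreducible_algebraic_set :: "nat \<Rightarrow> (nat \<Rightarrow> 'b::comm_ring_1) set \<Rightarrow> bool" where
  "irreducible_algebraic_set n V \<longleftrightarrow>
     algebraic_set n V \<and> V \<noteq> {} \<and>
     (\<forall>A B. algebraic_set n A \<longrightarrow> algebraic_set n B \<longrightarrow> V = A \<union> B \<longrightarrow> V = A \<or> V = B)"

definition mpoly_ideal :: "nat \<Rightarrow> 'b::comm_ring_1 mpoly set \<Rightarrow> 'b mpoly set" where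
  "mpoly_ideal n P = {(\<Sum>p\<in>T. c p * p) | T c. finite T \<and> T \<subseteq> P \<and> c ` T \<subseteq> mpolys n}"

text \<open>
  An algebraic set over the algebraic closure is defined over the ground field \<open>'k\<close> if its full
  vanishing ideal is generated by polynomials with coefficients in \<open>'k\<close>. Being the zero locus of
  such polynomials is weaker when \<open>'k\<close> is imperfect: for $a \in k \setminus k^p$ the zero locus of
  $X^p - a$ is a single point, but it is not defined over $k$ and has no $k$-rational point.
\<close>

definition defined_over_base :: "nat \<Rightarrow> (nat \<Rightarrow> 'k::field alg_closure) set \<Rightarrow> bool" where
  "defined_over_base n V \<longleftrightarrow>
     (\<exists>P :: 'k mpoly set. P \<subseteq> mpolys n \<and>
        vanishing_ideal n V = mpoly_ideal n (Poly_Mapping.map to_ac ` P))"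

text \<open>
  Since \<open>V\<close> consists of points over the algebraic closure, irreducibility of \<open>V\<close> is absolute
  irreducibility.
\<close>

definition abs_irreducible_variety :: "nat \<Rightarrow> (nat \<Rightarrow> 'k::field alg_closure) set \<Rightarrow> bool" where
  "abs_irreducible_variety n V \<longleftrightarrow> irreducible_algebraic_set n V \<and> defined_over_base n V"

definition pseudo_algebraically_closed :: "'k::field itself \<Rightarrow> bool" where
  "pseudo_algebraically_closed (_ :: 'k itself) \<longleftrightarrow>
     (\<forall>n (V :: (nat \<Rightarrow> 'k alg_closure) set). abs_irreducible_variety n V \<longrightarrow>
        (\<exists>x\<in>V. \<forall>i<n. x i \<in> range to_ac))"


section \<open>Definability in the language of rings\<close>

datatype ring_term =
  Var nat | Zero | One | Plus ring_term ring_term | Minus ring_term | Times ring_term ring_term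

datatype ring_formula =
  Eq ring_term ring_term | Neg ring_formula | And ring_formula ring_formula
| Exists nat ring_formula

primrec term_vars :: "ring_term \<Rightarrow> nat set" where
  "term_vars (Var i) = {i}"
| "term_vars Zero = {}"
| "term_vars One = {}"
| "term_vars (Plus s t) = term_vars s \<union> term_vars t"
| "term_vars (Minus t) = term_vars t"
| "term_vars (Times s t) = term_vars s \<union> term_vars t"

primrec free_vars :: "ring_formula \<Rightarrow> nat set" where
  "free_vars (Eq s t) = term_vars s \<union> term_vars t"
| "free_vars (Neg \<phi>) = free_vars \<phi>"
| "free_vars (And \<phi> \<psi>) = free_vars \<phi> \<union> free_vars \<psi>"
| "free_vars (Exists i \<phi>) = free_vars \<phi> - {i}"

primrec term_value :: "(nat \<Rightarrow> 'a::comm_ring_1) \<Rightarrow> ring_term \<Rightarrow> 'a" where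
  "term_value e (Var i) = e i"
| "term_value e Zero = 0"
| "term_value e One = 1"
| "term_value e (Plus s t) = term_value e s + term_value e t"
| "term_value e (Minus t) = - term_value e t"
| "term_value e (Times s t) = term_value e s * term_value e t"

primrec satisfies :: "(nat \<Rightarrow> 'a::comm_ring_1) \<Rightarrow> ring_formula \<Rightarrow> bool" where
  "satisfies e (Eq s t) \<longleftrightarrow> term_value e s = term_value e t"
| "satisfies e (Neg \<phi>) \<longleftrightarrow> \<not> satisfies e \<phi>"
| "satisfies e (And \<phi> \<psi>) \<longleftrightarrow> satisfies e \<phi> \<and> satisfies e \<psi>"
| "satisfies e (Exists i \<phi>) \<longleftrightarrow> (\<exists>a. satisfies (e(i := a)) \<phi>)"

definition definable_without_parameters :: "'a::comm_ring_1 set \<Rightarrow> bool" where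
  "definable_without_parameters A \<longleftrightarrow>
     (\<exists>\<phi>. free_vars \<phi> \<subseteq> {0} \<and> (\<forall>e. e 0 \<in> A \<longleftrightarrow> satisfies e \<phi>))"

definition valuation_definable :: "('a::field \<Rightarrow> 'g::linordered_ab_group_add) \<Rightarrow> bool" where
  "valuation_definable v \<longleftrightarrow> definable_without_parameters (valuation_ring v)"

end

theory Submission
  imports Defs
begin

text \<open>
  Let \<open>f\<close> be a monic polynomial over \<open>\<O>\<close> whose reduction is irreducible and separable and has no
  zero. Then all inverse values \<open>1 / f x\<close> with \<open>x \<in> K\<close> lie in \<open>\<O>\<close>.
  Conversely, the curve \<open>1 / \<delta> = 1 / f y - 1 / f z\<close>, rewritten as
  \<open>(f y - \<delta>) (f z + \<delta>) = - \<delta>\<^sup>2\<close>, is absolutely irreducible for almost all \<open>\<delta>\<close>, so it has points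
  over the PAC residue field, and Hensel's lemma gives
  \<open>\<O> = S f := {1 / f x + 1 / f y - 1 / f z | x y z}\<close>.

  The parameters of this definition are removed by quantifying over all \<open>f\<close>, together with a Bezout
  identity \<open>A f + B f' = 1\<close>, such that \<open>f\<close> has no zero in \<open>K\<close> and \<open>S f\<close> is closed under
  multiplication and contains the coefficients of \<open>f\<close>, \<open>A\<close>, \<open>B\<close>. For any such \<open>f\<close>, henselianity bounds
  the inverse values by an element \<open>d\<close> of \<open>S f\<close>, so \<open>S f \<subseteq> d \<O>\<close>; now \<open>d\<^sup>2 \<in> S f\<close> yields \<open>d \<in> \<O>\<close> and
  \<open>S f \<subseteq> \<O>\<close>.
\<close>

subsection \<open>Polynomials in two variables\<close>

lemma poly_map_poly_add:
  assumes "h 0 = 0" "\<And>a b. h (a + b) = h a + h b"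
  shows "poly (map_poly h (p + q)) x = poly (map_poly h p) x + poly (map_poly h q) x"
proof -
  have "map_poly h (p + q) = map_poly h p + map_poly h q"
    by (rule poly_eqI) (simp add: coeff_map_poly assms)
  then show ?thesis by simp
qed

lemma poly_map_poly_mult:
  fixes h :: "'a::comm_ring_1 \<Rightarrow> 'b::comm_ring_1"
  assumes "h 0 = 0" "\<And>a b. h (a + b) = h a + h b" "\<And>a b. h (a * b) = h a * h b"
  shows "poly (map_poly h (p * q)) x = poly (map_poly h p) x * poly (map_poly h q) x"
proof (induction p)
  case (pCons a p)
  have "map_poly h (smult a q) = smult (h a) (map_poly h q)"
    by (rule poly_eqI) (simp add: coeff_map_poly assms)
  then show ?case
    using pCons
    by (simp add: poly_map_poly_add assms(1,2) map_poly_pCons algebra_simps)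
qed simp

text \<open>A sparse polynomial is the finite sum of its terms, so a property stable under addition
  has to be checked on single terms only. The empty sum is a term with coefficient 0.\<close>

lemma poly_mapping_additive_induct [case_names single add]:
  fixes p :: "'a \<Rightarrow>\<^sub>0 'b::comm_monoid_add"
  assumes "\<And>k c. P (Poly_Mapping.single k c)" "\<And>p q. P p \<Longrightarrow> P q \<Longrightarrow> P (p + q)"
  shows "P p"
proof -
  have "p = (\<Sum>k\<in>Poly_Mapping.keys p. Poly_Mapping.single k (Poly_Mapping.lookup p k))"
    by (rule poly_mapping_eqI)
      (auto simp: lookup_sum lookup_single when_def in_keys_iff sum.delta' sum.delta)
  moreover have "P (\<Sum>k\<in>A. Poly_Mapping.single k (Poly_Mapping.lookup p k))" if "finite A" for A
    using that
  proof (induction A rule: finite_induct)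
    case empty
    show ?case using assms(1)[of undefined 0] by simp
  qed (simp add: assms)
  ultimately show ?thesis by (metis finite_keys)
qed

lemma lookup_map:
  assumes "f 0 = 0"
  shows "Poly_Mapping.lookup (Poly_Mapping.map f p) k = f (Poly_Mapping.lookup p k)"
  using assms by (simp add: map.rep_eq when_def)

lemma map_add_hom:
  assumes "f 0 = 0" "\<And>a b. f (a + b) = f a + f b"
  shows "Poly_Mapping.map f (p + q) = Poly_Mapping.map f p + Poly_Mapping.map f q"
  by (rule poly_mapping_eqI) (simp add: lookup_map lookup_add assms)

lemma map_mult_hom:
  fixes p q :: "'m::comm_monoid_add \<Rightarrow>\<^sub>0 'b::comm_ring_1" and f :: "'b \<Rightarrow> 'c::comm_ring_1"
  assumes "f 0 = 0" "\<And>a b. f (a + b) = f a + f b" "\<And>a b. f (a * b) = f a * f b"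
  shows "Poly_Mapping.map f (p * q) = Poly_Mapping.map f p * Poly_Mapping.map f q"
proof (induction p rule: poly_mapping_additive_induct)
  case (single k c)
  show ?case
    by (induction q rule: poly_mapping_additive_induct)
      (simp_all add: mult_single assms map_add_hom distrib_left)
qed (simp add: map_add_hom assms distrib_right)

section \<open>Evaluation of multivariate polynomials\<close>

definition monomial_eval :: "(nat \<Rightarrow>\<^sub>0 nat) \<Rightarrow> (nat \<Rightarrow> 'b::comm_ring_1) \<Rightarrow> 'b" where
  "monomial_eval m x = (\<Prod>i\<in>Poly_Mapping.keys m. x i ^ Poly_Mapping.lookup m i)"

text \<open>Variables of exponent 0 contribute a factor 1. Enlarging the index set lets two
  monomials be multiplied over a common one.\<close>

lemma monomial_eval_superset:
  assumes "finite A" "Poly_Mapping.keys m \<subseteq> A"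
  shows "monomial_eval m x = (\<Prod>i\<in>A. x i ^ Poly_Mapping.lookup m i)"
  unfolding monomial_eval_def
  by (rule prod.mono_neutral_left) (use assms in \<open>auto simp: in_keys_iff\<close>)

lemma monomial_eval_add: "monomial_eval (m + n) x = monomial_eval m x * monomial_eval n x"
proof -
  let ?A = "Poly_Mapping.keys m \<union> Poly_Mapping.keys n"
  have "Poly_Mapping.keys (m + n) \<subseteq> ?A"
    by (rule keys_add)
  then show ?thesis
    by (simp add: monomial_eval_superset[of ?A] lookup_add power_add prod.distrib)
qed

lemma mpoly_eval_superset:
  assumes "finite A" "Poly_Mapping.keys p \<subseteq> A"
  shows "mpoly_eval p x = (\<Sum>m\<in>A. Poly_Mapping.lookup p m * monomial_eval m x)"
  unfolding mpoly_eval_def monomial_eval_def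
  by (rule sum.mono_neutral_left) (use assms in \<open>auto simp: in_keys_iff\<close>)

lemma mpoly_eval_add: "mpoly_eval (p + q) x = mpoly_eval p x + mpoly_eval q x"
proof -
  let ?A = "Poly_Mapping.keys p \<union> Poly_Mapping.keys q"
  have "Poly_Mapping.keys (p + q) \<subseteq> ?A"
    by (rule keys_add)
  then show ?thesis
    by (simp add: mpoly_eval_superset[of ?A] lookup_add distrib_right sum.distrib)
qed

lemma mpoly_eval_single: "mpoly_eval (Poly_Mapping.single m c) x = c * monomial_eval m x"
  by (subst mpoly_eval_superset[of "{m}"]) auto

lemma mpoly_eval_mult: "mpoly_eval (p * q) x = mpoly_eval p x * mpoly_eval q x"
proof (induction p rule: poly_mapping_additive_induct)
  case (single k c)
  show ?case
    by (induction q rule: poly_mapping_additive_induct)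
      (simp_all add: mult_single mpoly_eval_single mpoly_eval_add monomial_eval_add algebra_simps)
qed (simp add: mpoly_eval_add distrib_right)

definition mpoly_var :: "nat \<Rightarrow> 'b::comm_ring_1 mpoly" where
  "mpoly_var i = Poly_Mapping.single (Poly_Mapping.single i 1) 1"

lemma mpoly_eval_var: "mpoly_eval (mpoly_var i) x = x i"
  by (simp add: mpoly_var_def mpoly_eval_single monomial_eval_def)

text \<open>A polynomial in $X_0$ and $X_1$ is viewed as a polynomial in $X_1$ over the polynomials in $X_0$.\<close>

definition mpoly_of_poly :: "'b::comm_ring_1 poly \<Rightarrow> 'b mpoly" where
  "mpoly_of_poly p = poly (map_poly (Poly_Mapping.single 0) p) (mpoly_var 0)"

definition mpoly_of_poly2 :: "'b::comm_ring_1 poly poly \<Rightarrow> 'b mpoly" where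
  "mpoly_of_poly2 p = poly (map_poly mpoly_of_poly p) (mpoly_var 1)"

lemma mpoly_of_poly_hom:
  "mpoly_of_poly 0 = 0" "mpoly_of_poly (p + q) = mpoly_of_poly p + mpoly_of_poly q"
  "mpoly_of_poly (p * q) = mpoly_of_poly p * mpoly_of_poly q"
  unfolding mpoly_of_poly_def
  by (simp_all add: poly_map_poly_add poly_map_poly_mult single_add mult_single)

lemma mpoly_of_poly_pCons:
  "mpoly_of_poly (pCons a p) = Poly_Mapping.single 0 a + mpoly_var 0 * mpoly_of_poly p"
  unfolding mpoly_of_poly_def by (simp add: map_poly_pCons)

lemma mpoly_of_poly2_hom:
  "mpoly_of_poly2 0 = 0" "mpoly_of_poly2 (p + q) = mpoly_of_poly2 p + mpoly_of_poly2 q"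
  "mpoly_of_poly2 (p * q) = mpoly_of_poly2 p * mpoly_of_poly2 q"
  unfolding mpoly_of_poly2_def
  by (simp_all add: poly_map_poly_add poly_map_poly_mult mpoly_of_poly_hom)

lemma mpoly_of_poly2_pCons:
  "mpoly_of_poly2 (pCons a p) = mpoly_of_poly a + mpoly_var 1 * mpoly_of_poly2 p"
  unfolding mpoly_of_poly2_def by (simp add: map_poly_pCons mpoly_of_poly_hom)

lemma mpoly_eval_mpoly_of_poly: "mpoly_eval (mpoly_of_poly p) x = poly p (x 0)"
proof (induction p)
  case 0
  show ?case by (simp add: mpoly_of_poly_hom mpoly_eval_def)
qed (simp add: mpoly_of_poly_pCons mpoly_eval_add mpoly_eval_mult mpoly_eval_var
    mpoly_eval_single monomial_eval_def)

lemma mpoly_eval_mpoly_of_poly2: "mpoly_eval (mpoly_of_poly2 p) x = poly (poly p [:x 1:]) (x 0)"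
proof (induction p)
  case 0
  show ?case by (simp add: mpoly_of_poly2_hom mpoly_eval_def)
qed (simp add: mpoly_of_poly2_pCons mpoly_eval_add mpoly_eval_mult mpoly_eval_var
    mpoly_eval_mpoly_of_poly)

section \<open>Polynomials in finitely many variables and change of coefficients\<close>

lemma mpolys_add: "p \<in> mpolys n \<Longrightarrow> q \<in> mpolys n \<Longrightarrow> p + q \<in> mpolys n"
  unfolding mpolys_def using keys_add[of p q] by blast

lemma mpolys_mult:
  assumes "p \<in> mpolys n" "q \<in> mpolys n"
  shows "p * q \<in> mpolys n"
proof -
  have "Poly_Mapping.keys k \<subseteq> {..<n}" if k: "k \<in> Poly_Mapping.keys (p * q)" for k
  proof -
    obtain a b where ab: "k = a + b" "a \<in> Poly_Mapping.keys p" "b \<in> Poly_Mapping.keys q"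
      using k keys_mult[of p q] by blast
    then have "Poly_Mapping.keys a \<subseteq> {..<n}" "Poly_Mapping.keys b \<subseteq> {..<n}"
      using assms by (auto simp: mpolys_def)
    then show ?thesis
      using keys_add[of a b] ab(1) by blast
  qed
  then show ?thesis by (simp add: mpolys_def)
qed

lemma mpolys_var: "i < n \<Longrightarrow> mpoly_var i \<in> mpolys n"
  by (auto simp: mpolys_def mpoly_var_def)

lemma mpolys_const: "Poly_Mapping.single 0 c \<in> mpolys n"
  by (auto simp: mpolys_def)

lemma mpolys_mpoly_of_poly: "0 < n \<Longrightarrow> mpoly_of_poly p \<in> mpolys n"
proof (induction p)
  case 0
  show ?case by (simp add: mpoly_of_poly_hom mpolys_def)
qed (simp add: mpoly_of_poly_pCons mpolys_add mpolys_mult mpolys_var mpolys_const)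

lemma mpolys_mpoly_of_poly2: "mpoly_of_poly2 p \<in> mpolys 2"
proof (induction p)
  case 0
  show ?case by (simp add: mpoly_of_poly2_hom mpolys_def)
qed (simp add: mpoly_of_poly2_pCons mpolys_add mpolys_mult mpolys_var mpolys_mpoly_of_poly)

text \<open>Each monomial in two variables is the image of an explicit product. Surjectivity moves
  elements of a vanishing ideal into \<open>'b poly poly\<close>, where prime elements and
  pseudo-division are at hand.\<close>

lemma range_mpoly_of_poly2: "range mpoly_of_poly2 = mpolys 2"
proof
  show "range mpoly_of_poly2 \<subseteq> mpolys 2"
    using mpolys_mpoly_of_poly2 by blast
  have var0: "mpoly_of_poly2 [:[:0, 1:]:] = mpoly_var 0"
    and var1: "mpoly_of_poly2 [:0, 1:] = mpoly_var 1"
    and const: "mpoly_of_poly2 [:[:c:]:] = Poly_Mapping.single 0 c" for c :: 'a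
    by (simp_all add: mpoly_of_poly2_pCons mpoly_of_poly2_hom mpoly_of_poly_pCons mpoly_of_poly_hom
        one_pCons)
  have one: "mpoly_of_poly2 1 = (1 :: 'a mpoly)"
    using const[of 1] by (simp add: one_pCons)
  have power: "mpoly_of_poly2 (p ^ k) = mpoly_of_poly2 p ^ k" for p :: "'a poly poly" and k
    by (induction k) (simp_all add: one mpoly_of_poly2_hom)
  have var_power: "mpoly_var i ^ k = Poly_Mapping.single (Poly_Mapping.single i k) (1 :: 'a)" for i k
    by (induction k) (simp_all add: mpoly_var_def mult_single single_add[symmetric])
  show "mpolys 2 \<subseteq> range (mpoly_of_poly2 :: 'a poly poly \<Rightarrow> _)"
  proof
    fix p :: "'a mpoly" assume p: "p \<in> mpolys 2"
    have single: "Poly_Mapping.single m c \<in> range mpoly_of_poly2"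
      if "Poly_Mapping.keys m \<subseteq> {..<2}" for m and c :: 'a
    proof -
      let ?i = "Poly_Mapping.lookup m 0" and ?j = "Poly_Mapping.lookup m 1"
      have m: "m = Poly_Mapping.single 0 ?i + Poly_Mapping.single 1 ?j"
      proof (rule poly_mapping_eqI)
        fix k show "Poly_Mapping.lookup m k =
            Poly_Mapping.lookup (Poly_Mapping.single 0 ?i + Poly_Mapping.single 1 ?j) k"
        proof (cases "k = 0 \<or> k = 1")
          case False
          then have "k \<notin> Poly_Mapping.keys m" using that by auto
          then show ?thesis using False by (simp add: lookup_add lookup_single in_keys_iff)
        qed (auto simp: lookup_add lookup_single)
      qed
      have "mpoly_of_poly2 ([:[:c:]:] * [:[:0, 1:]:] ^ ?i * [:0, 1:] ^ ?j) = Poly_Mapping.single m c"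
        unfolding mpoly_of_poly2_hom power var0 var1 const var_power
        using m by (simp add: mult_single)
      then show ?thesis by (metis rangeI)
    qed
    have "p = (\<Sum>k\<in>Poly_Mapping.keys p. Poly_Mapping.single k (Poly_Mapping.lookup p k))"
      by (rule poly_mapping_eqI)
        (auto simp: lookup_sum lookup_single when_def in_keys_iff sum.delta' sum.delta)
    moreover have "(\<Sum>k\<in>A. Poly_Mapping.single k (Poly_Mapping.lookup p k)) \<in> range mpoly_of_poly2"
      if "finite A" "A \<subseteq> Poly_Mapping.keys p" for A
      using that
    proof (induction A rule: finite_induct)
      case empty
      show ?case using mpoly_of_poly2_hom(1) by (metis rangeI sum.empty)
    next
      case (insert k A)
      then have "Poly_Mapping.single k (Poly_Mapping.lookup p k) \<in> range mpoly_of_poly2"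
        using p by (intro single) (auto simp: mpolys_def)
      with insert show ?case
        by (auto simp: mpoly_of_poly2_hom(2)[symmetric])
    qed
    ultimately show "p \<in> range mpoly_of_poly2" by (metis finite_keys order_refl)
  qed
qed

lemma map_mpoly_of_poly:
  assumes f: "f 0 = 0" "f 1 = 1" "\<And>a b. f (a + b) = f a + f b" "\<And>a b. f (a * b) = f a * f b"
  shows "Poly_Mapping.map f (mpoly_of_poly p) = mpoly_of_poly (map_poly f p)"
proof (induction p)
  case 0
  show ?case by (simp add: mpoly_of_poly_hom) (rule poly_mapping_eqI, simp add: lookup_map f)
qed (simp add: mpoly_of_poly_pCons map_add_hom map_mult_hom f mpoly_var_def map_poly_pCons)

text \<open>Applied with \<open>f = to_ac\<close>, this exhibits the equation of a curve over the
  closure as the image of one over the ground field, as \<open>defined_over_base\<close>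
  demands.\<close>

lemma map_mpoly_of_poly2:
  assumes f: "f 0 = 0" "f 1 = 1" "\<And>a b. f (a + b) = f a + f b" "\<And>a b. f (a * b) = f a * f b"
  shows "Poly_Mapping.map f (mpoly_of_poly2 p) = mpoly_of_poly2 (map_poly (map_poly f) p)"
proof (induction p)
  case 0
  show ?case by (simp add: mpoly_of_poly2_hom) (rule poly_mapping_eqI, simp add: lookup_map f)
qed (simp add: mpoly_of_poly2_pCons map_add_hom map_mult_hom f mpoly_var_def map_poly_pCons
    map_mpoly_of_poly)

subsection \<open>The curves $P(X) Q(Y) = e$\<close>

text \<open>A common linear factor is split off from \<open>p\<close> and \<open>g\<close>. The
  zeros of the remaining factor of \<open>p\<close> differ from the one removed, because that zero
  was simple, so they are still zeros of the cofactor of \<open>g\<close>.\<close>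

lemma simple_roots_dvd:
  fixes p g :: "'l::alg_closed_field poly"
  assumes "p \<noteq> 0" "\<And>a. poly p a = 0 \<Longrightarrow> poly (pderiv p) a \<noteq> 0"
    "\<And>a. poly p a = 0 \<Longrightarrow> poly g a = 0"
  shows "p dvd g"
  using assms
proof (induction "Polynomial.degree p" arbitrary: p g)
  case 0
  then have "is_unit p" by (metis is_unit_iff_degree)
  then show ?case by (rule unit_imp_dvd)
next
  case (Suc n)
  obtain a where a: "poly p a = 0"
    using alg_closed_imp_poly_has_root[of p] Suc.hyps(2) by auto
  then have "poly g a = 0" by (rule Suc.prems)
  with a obtain q h where q: "p = [:-a, 1:] * q" and h: "g = [:-a, 1:] * h"
    by (metis dvdE poly_eq_0_iff_dvd)
  have q0: "q \<noteq> 0" using q Suc.prems(1) by auto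
  then have "Polynomial.degree p = Suc (Polynomial.degree q)"
    unfolding q by (subst degree_mult_eq) auto
  moreover have pderiv_p: "poly (pderiv p) b = poly q b + (b - a) * poly (pderiv q) b" for b
    unfolding q pderiv_mult poly_add poly_mult by (simp add: pderiv_pCons)
  moreover have "poly (pderiv q) b \<noteq> 0" if "poly q b = 0" for b
    using Suc.prems(2)[of b] that unfolding pderiv_p by (auto simp: q)
  moreover have "poly h b = 0" if "poly q b = 0" for b
  proof -
    have "b \<noteq> a"
      using Suc.prems(2)[OF a] that unfolding pderiv_p by auto
    then show ?thesis
      using Suc.prems(3)[of b] that by (auto simp: q h)
  qed
  ultimately have "q dvd h"
    using Suc.hyps q0 by auto
  then show ?case unfolding q h by (rule mult_dvd_mono[OF dvd_refl])
qed

lemma degree_diff_const: "Polynomial.degree (p - [:c:]) = Polynomial.degree p"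
  for p :: "'l::comm_ring_1 poly"
  by (cases p) (simp add: degree_pCons_eq_if)

text \<open>The polynomial P(X) Q(Y) - e, with \<open>Y\<close> as outer variable and coefficients
  in \<open>X\<close>; \<open>poly (poly H [:y:]) x\<close> is its value at (x, y).\<close>

definition curve_poly :: "'l::comm_ring_1 poly \<Rightarrow> 'l poly \<Rightarrow> 'l \<Rightarrow> 'l poly poly" where
  "curve_poly P Q e = Polynomial.smult P (map_poly (\<lambda>c. [:c:]) Q) - [:[:e:]:]"

lemma poly_map_const: "poly (poly (map_poly (\<lambda>c. [:c:]) Q) [:y:]) x = poly Q y"
  for Q :: "'l::comm_ring_1 poly"
  by (induction Q) (simp_all add: map_poly_pCons)

lemma poly_curve_poly: "poly (poly (curve_poly P Q e) [:y:]) x = poly P x * poly Q y - e"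
  unfolding curve_poly_def by (simp add: poly_map_const)

lemma coeff_curve_poly:
  "Polynomial.coeff (curve_poly P Q e) i =
    Polynomial.smult (Polynomial.coeff Q i) P - (if i = 0 then [:e:] else 0)"
  by (cases i) (simp_all add: curve_poly_def coeff_map_poly mult.commute)

lemma poly_map_to_ac: "poly (map_poly to_ac p) (to_ac c) = to_ac (poly p c)"
  for p :: "'k::field poly"
  by (induction p) (simp_all add: map_poly_pCons)

lemma map_poly_to_ac_mult: "map_poly to_ac (p * q) = map_poly to_ac p * map_poly to_ac q"
  for p q :: "'k::field poly"
  by (rule poly_eqI) (simp add: coeff_map_poly coeff_mult to_ac_sum)

lemma pderiv_map_to_ac: "pderiv (map_poly to_ac p) = map_poly to_ac (pderiv p)"
  for p :: "'k::field poly"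
  by (rule poly_eqI) (simp add: coeff_pderiv coeff_map_poly)

lemma map_curve_poly:
  fixes P Q :: "'k::field poly"
  shows "map_poly (map_poly to_ac) (curve_poly P Q e) =
    curve_poly (map_poly to_ac P) (map_poly to_ac Q) (to_ac e)"
  by (intro poly_eqI) (simp add: coeff_map_poly coeff_curve_poly coeff_pCons split: nat.split)

lemma degree_curve_poly:
  fixes P Q :: "'l::field poly"
  assumes "P \<noteq> 0" "0 < Polynomial.degree Q"
  shows "Polynomial.degree (curve_poly P Q e) = Polynomial.degree Q"
    and "lead_coeff (curve_poly P Q e) = Polynomial.smult (lead_coeff Q) P"
proof -
  have coeff: "Polynomial.coeff (curve_poly P Q e) i = Polynomial.smult (Polynomial.coeff Q i) P"
    if "i > 0" for i
    using that by (simp add: coeff_curve_poly)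
  show deg: "Polynomial.degree (curve_poly P Q e) = Polynomial.degree Q"
  proof (rule antisym)
    show "Polynomial.degree (curve_poly P Q e) \<le> Polynomial.degree Q"
      by (rule degree_le) (use coeff in \<open>auto simp: coeff_eq_0\<close>)
    show "Polynomial.degree Q \<le> Polynomial.degree (curve_poly P Q e)"
      using assms coeff[OF assms(2)] by (intro le_degree) auto
  qed
  show "lead_coeff (curve_poly P Q e) = Polynomial.smult (lead_coeff Q) P"
    unfolding deg using coeff[OF assms(2)] .
qed

text \<open>
  At a simple zero \<open>\<alpha>\<close> of \<open>P\<close> the polynomial specialises to the constant \<open>- e\<close>, so both factors of
  a proper factorisation would have a leading coefficient vanishing at \<open>\<alpha>\<close>, a zero of order one of
  the product of these coefficients.
\<close>

lemma irreducible_curve_poly: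
  fixes P Q :: "'l::field poly"
  assumes \<alpha>: "poly P \<alpha> = 0" "poly (pderiv P) \<alpha> \<noteq> 0" and Q: "0 < Polynomial.degree Q" and e: "e \<noteq> 0"
  shows "Factorial_Ring.irreducible (curve_poly P Q e)"
proof (rule Factorial_Ring.irreducibleI)
  let ?H = "curve_poly P Q e"
  have P0: "P \<noteq> 0" using \<alpha>(2) by auto
  note deg = degree_curve_poly[OF P0 Q, of e]
  show "?H \<noteq> 0" using deg(1) Q by auto
  show "\<not> is_unit ?H"
  proof
    assume "is_unit ?H"
    then have "Polynomial.degree ?H = 0" by (auto simp: is_unit_poly_iff)
    then show False using deg(1) Q by simp
  qed
  \<comment> \<open>A factor of degree 0 in \<open>Y\<close> divides every coefficient in
    \<open>X\<close>. The leading one is a nonzero multiple of \<open>P\<close> and the zeroth is a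
    multiple of \<open>P\<close> minus \<open>e\<close>, so the factor divides the nonzero constant
    \<open>e\<close>.\<close>
  have unit: "is_unit A" if AB: "?H = A * B" and A: "Polynomial.degree A = 0" for A B
  proof -
    obtain a where a: "A = [:a:]" using A by (metis degree_eq_zeroE)
    have dvd: "a dvd Polynomial.coeff ?H i" for i
      unfolding AB a by simp
    have "a dvd P"
      using dvd[of "Polynomial.degree ?H"] deg(2) Q by (cases "Q = 0") (simp_all add: dvd_smult_iff)
    then have "a dvd Polynomial.smult (Polynomial.coeff Q 0) P"
      by (rule dvd_smult)
    moreover have "Polynomial.coeff ?H 0 = Polynomial.smult (Polynomial.coeff Q 0) P - [:e:]"
      by (simp add: curve_poly_def coeff_map_poly mult.commute)
    ultimately have "a dvd Polynomial.smult (Polynomial.coeff Q 0) P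
        - (Polynomial.smult (Polynomial.coeff Q 0) P - [:e:])"
      using dvd[of 0] by (metis dvd_diff)
    then have "a dvd [:e:]" by simp
    then have "is_unit a"
      using e by (metis dvd_trans is_unit_triv)
    then show ?thesis using a by (simp add: is_unit_const_poly_iff)
  qed
  \<comment> \<open>Substituting \<alpha> for \<open>X\<close> turns the product into the constant
    \<open>- e\<close>, so both specialised factors are constant; if the leading coefficient of
    \<open>A\<close> survives, \<open>A\<close> itself has degree 0 in \<open>Y\<close>.\<close>
  have const: "Polynomial.degree A = 0"
    if AB: "?H = A * B" and lead: "poly (lead_coeff A) \<alpha> \<noteq> 0" for A B
  proof -
    let ?s = "map_poly (\<lambda>p. poly p \<alpha>)"
    have "?s ?H = ?s A * ?s B"
      unfolding AB by (intro poly_eqI) (simp add: coeff_map_poly coeff_mult poly_sum)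
    moreover have "?s ?H = [:- e:]"
      by (intro poly_eqI)
        (auto simp: coeff_map_poly curve_poly_def \<alpha>(1) coeff_pCons split: nat.split)
    ultimately have "?s A * ?s B = [:- e:]" by simp
    then have "Polynomial.degree (?s A) = 0"
      using e by (metis degree_mult_eq degree_pCons_0 add_is_0 mult_eq_0_iff pCons_eq_0_iff
          neg_equal_0_iff_equal)
    then show ?thesis using map_poly_degree_eq[of "\<lambda>p. poly p \<alpha>" A] lead by simp
  qed
  show "is_unit A \<or> is_unit B" if AB: "?H = A * B" for A B
  proof (rule ccontr)
    assume *: "\<not> (is_unit A \<or> is_unit B)"
    have BA: "?H = B * A" using AB by (simp add: mult.commute)
    have "poly (lead_coeff A) \<alpha> = 0" "poly (lead_coeff B) \<alpha> = 0"
      using * unit const AB BA by metis+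
    moreover have "lead_coeff A * lead_coeff B = Polynomial.smult (lead_coeff Q) P"
      using deg(2) unfolding AB by (simp add: lead_coeff_mult)
    ultimately have "poly (pderiv (Polynomial.smult (lead_coeff Q) P)) \<alpha> = 0"
      by (metis (no_types, lifting) add.right_neutral mult_zero_left mult_zero_right
          pderiv_mult poly_add poly_mult)
    then show False using \<alpha>(2) Q by (auto simp: pderiv_smult)
  qed
qed

section \<open>The vanishing ideal of the curve and its rational points\<close>

lemma infinite_UNIV_alg_closed: "infinite (UNIV :: 'l::alg_closed_field set)"
proof
  assume fin: "finite (UNIV :: 'l set)"
  define p :: "'l poly" where "p = (\<Prod>a\<in>UNIV. [:- a, 1:]) + 1"
  have "Polynomial.degree (\<Prod>a\<in>UNIV. [:- a, 1:] :: 'l poly) = card (UNIV :: 'l set)"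
    by (subst degree_prod_eq_sum_degree) auto
  moreover have "card (UNIV :: 'l set) > 0" using fin by (simp add: card_gt_0_iff)
  ultimately have "Polynomial.degree p > 0"
    unfolding p_def by (subst degree_add_eq_left) auto
  then obtain x where "poly p x = 0" using alg_closed_imp_poly_has_root by blast
  moreover have "poly p x = 1" for x
    unfolding p_def using fin by (simp add: poly_prod prod_zero_iff)
  ultimately show False by simp
qed

text \<open>Pseudo-division by the curve polynomial in \<open>Y\<close> leaves a remainder of degree
  below that of \<open>Q\<close>. For almost all \<open>x\<close> the polynomial
  \<open>Q - e / P x\<close> has only simple zeros, all of them zeros of the remainder at
  \<open>x\<close>; so the remainder vanishes there, hence identically. The multiplier from
  pseudo-division involves only \<open>X\<close> and is removed by primality.\<close>

lemma curve_poly_vanishing: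
  fixes P Q :: "'l::{alg_closed_field, euclidean_ring_gcd, semiring_gcd_mult_normalize} poly"
  assumes \<alpha>: "poly P \<alpha> = 0" "poly (pderiv P) \<alpha> \<noteq> 0" and Q: "pderiv Q \<noteq> 0" and e: "e \<noteq> 0"
    and G: "\<And>x y. poly P x * poly Q y = e \<Longrightarrow> poly (poly G [:y:]) x = 0"
  shows "curve_poly P Q e dvd G"
proof -
  let ?H = "curve_poly P Q e"
  have degQ: "0 < Polynomial.degree Q"
  proof (rule ccontr)
    assume "\<not> 0 < Polynomial.degree Q"
    then obtain c where "Q = [:c:]" by (metis degree_eq_zeroE not_gr_zero)
    then show False using Q by simp
  qed
  have P0: "P \<noteq> 0" using \<alpha>(2) by auto
  have irr: "Factorial_Ring.irreducible ?H"
    by (rule irreducible_curve_poly[OF \<alpha> degQ e])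
  then have prime: "prime_elem ?H"
    by (rule irreducible_imp_prime_elem)
  have H0: "?H \<noteq> 0" using irr by auto
  note degH = degree_curve_poly(1)[OF P0 degQ, of e]
  define r where "r = pseudo_mod G ?H"
  obtain a q where aq: "a \<noteq> 0" "Polynomial.smult a G = ?H * q + r"
    using pseudo_mod(1)[OF H0, of G] unfolding r_def by blast
  have deg_r: "r = 0 \<or> Polynomial.degree r < Polynomial.degree Q"
    using pseudo_mod(2)[OF H0, of G] degH unfolding r_def by simp
  have r_vanish: "poly (poly r [:y:]) x = 0" if "poly P x * poly Q y = e" for x y
  proof -
    have "poly (poly (Polynomial.smult a G) [:y:]) x = 0"
      using G[OF that] by simp
    then show ?thesis
      unfolding aq(2) using that by (simp add: poly_curve_poly)
  qed
  \<comment> \<open>Outside \<open>bad\<close> every zero \<open>y\<close> of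
    \<open>Q - e / P x\<close> is simple: a multiple zero would satisfy \<open>Q' y = 0\<close> and
    \<open>P x = e / Q y\<close>.\<close>
  define bad where "bad = {x. poly P x = 0} \<union> (\<Union>y\<in>{y. poly (pderiv Q) y = 0}. {x. poly (P - [:e / poly Q y:]) x = 0})"
  have "P - [:c:] \<noteq> 0" for c
    using \<alpha>(2) by auto
  then have "finite bad"
    unfolding bad_def using P0 Q by (intro finite_UnI finite_UN_I poly_roots_finite) auto
  then have inf: "infinite (- bad)"
    using infinite_UNIV_alg_closed by (metis finite_compl)
  have "Polynomial.coeff r i = 0" for i
  proof -
    have "poly (Polynomial.coeff r i) x = 0" if x: "x \<notin> bad" for x
    proof -
      let ?q = "Q - [:e / poly P x:]"
      define s where "s = map_poly (\<lambda>p. poly p x) r"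
      have s: "poly s y = poly (poly r [:y:]) x" for y
        unfolding s_def by (induction r) (simp_all add: map_poly_pCons)
      have Px: "poly P x \<noteq> 0" using x by (auto simp: bad_def)
      have "?q dvd s"
      proof (rule simple_roots_dvd)
        show "?q \<noteq> 0" using Q by auto
        fix y assume "poly ?q y = 0"
        then have y: "poly P x * poly Q y = e" using Px by (simp add: field_simps)
        then show "poly s y = 0" using r_vanish s by simp
        have "poly P x = e / poly Q y" using y e by (auto simp: field_simps)
        then show "poly (pderiv ?q) y \<noteq> 0"
          using x by (auto simp: bad_def pderiv_diff)
      qed
      moreover have "Polynomial.degree ?q = Polynomial.degree Q"
        using degQ by (simp add: degree_diff_const)
      moreover have "s = 0 \<or> Polynomial.degree s < Polynomial.degree Q"
        using deg_r unfolding s_def by (auto intro: le_less_trans[OF map_poly_degree_leq])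
      ultimately have "s = 0" using dvd_imp_degree_le by (metis not_less)
      then have "Polynomial.coeff s i = 0" by simp
      then show ?thesis unfolding s_def by (simp add: coeff_map_poly)
    qed
    then have "- bad \<subseteq> {x. poly (Polynomial.coeff r i) x = 0}" by auto
    then show ?thesis using inf poly_roots_finite finite_subset by blast
  qed
  then have "r = 0" by (intro poly_eqI) simp
  then have "?H dvd [:a:] * G" using aq(2) by simp
  then have "?H dvd [:a:] \<or> ?H dvd G" using prime prime_elem_dvd_mult_iff by blast
  moreover have "\<not> ?H dvd [:a:]"
  proof
    assume "?H dvd [:a:]"
    then have "Polynomial.degree ?H \<le> Polynomial.degree [:a:]"
      using aq(1) by (intro dvd_imp_degree_le) auto
    then show False using degH degQ by simp
  qed
  ultimately show ?thesis by blast
qed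

lemma mem_mpoly_ideal_singleton: "p \<in> mpoly_ideal n {h} \<longleftrightarrow> (\<exists>c\<in>mpolys n. p = c * h)"
proof
  assume "p \<in> mpoly_ideal n {h}"
  then obtain T c where T: "T \<subseteq> {h}" "c ` T \<subseteq> mpolys n" and p: "p = (\<Sum>q\<in>T. c q * q)"
    unfolding mpoly_ideal_def by auto
  from T(1) consider "T = {}" | "T = {h}" by blast
  then show "\<exists>c\<in>mpolys n. p = c * h"
  proof cases
    case 1
    then show ?thesis using p by (intro bexI[of _ 0]) (auto simp: mpolys_def)
  next
    case 2
    then show ?thesis using p T(2) by auto
  qed
next
  assume "\<exists>c\<in>mpolys n. p = c * h"
  then obtain c where c: "c \<in> mpolys n" "p = c * h" by blast
  show "p \<in> mpoly_ideal n {h}"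
    unfolding mpoly_ideal_def
    by (rule CollectI, rule exI[of _ "{h}"], rule exI[of _ "\<lambda>_. c"]) (use c in auto)
qed

text \<open>The simple zero \<alpha> makes the equation \<open>H\<close> prime, and together with
  \<open>pderiv Q \<noteq> 0\<close> it makes \<open>H\<close> generate the full vanishing ideal. As
  \<open>H\<close> comes from the ground field, the curve is an absolutely irreducible variety over
  it, and being PAC supplies a rational point.\<close>

lemma PAC_curve_point:
  fixes P Q :: "'k::field poly"
  assumes PAC: "pseudo_algebraically_closed TYPE('k)"
    and \<alpha>: "poly (map_poly to_ac P) \<alpha> = 0" "poly (pderiv (map_poly to_ac P)) \<alpha> \<noteq> 0"
    and Q: "pderiv Q \<noteq> 0" and e: "e \<noteq> 0"
  shows "\<exists>a b. poly P a * poly Q b = e"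
proof -
  let ?P = "map_poly to_ac P" and ?Q = "map_poly to_ac Q"
  let ?h = "curve_poly P Q e"
  define H where "H = curve_poly ?P ?Q (to_ac e)"
  have mapH: "Poly_Mapping.map to_ac (mpoly_of_poly2 ?h) = mpoly_of_poly2 H"
    unfolding H_def by (subst map_mpoly_of_poly2) (simp_all add: map_curve_poly)
  have e': "to_ac e \<noteq> 0" using e by simp
  have Q': "pderiv ?Q \<noteq> 0"
    using Q unfolding pderiv_map_to_ac by (simp add: map_poly_eq_0_iff)
  have degQ: "0 < Polynomial.degree ?Q"
    using Q' by (metis degree_eq_zeroE gr0I pderiv_singleton)
  define V where "V = zero_locus 2 {mpoly_of_poly2 H}"
  define pt :: "'k alg_closure \<Rightarrow> 'k alg_closure \<Rightarrow> nat \<Rightarrow> 'k alg_closure"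
    where "pt x y = (\<lambda>i\<in>{..<2}. if i = 0 then x else y)" for x y
  have V: "x \<in> V \<longleftrightarrow> x \<in> affine_space 2 \<and> poly ?P (x 0) * poly ?Q (x 1) = to_ac e" for x
    by (simp add: V_def zero_locus_def mpoly_eval_mpoly_of_poly2 H_def poly_curve_poly)
  have pt: "pt x y \<in> V \<longleftrightarrow> poly ?P x * poly ?Q y = to_ac e" for x y
    unfolding V by (simp add: pt_def affine_space_def)
  have dvd: "H dvd G" if "\<And>x. x \<in> V \<Longrightarrow> mpoly_eval (mpoly_of_poly2 G) x = 0" for G
    unfolding H_def
  proof (rule curve_poly_vanishing[OF \<alpha> Q' e'])
    fix x y assume "poly ?P x * poly ?Q y = to_ac e"
    then have "mpoly_eval (mpoly_of_poly2 G) (pt x y) = 0" using that pt by blast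
    then show "poly (poly G [:y:]) x = 0"
      by (simp add: mpoly_eval_mpoly_of_poly2 pt_def)
  qed
  have H_V: "mpoly_eval (mpoly_of_poly2 H) x = 0" if "x \<in> V" for x
    using that by (simp add: V_def zero_locus_def)
  have ideal: "vanishing_ideal 2 V = mpoly_ideal 2 (Poly_Mapping.map to_ac ` {mpoly_of_poly2 ?h})"
    unfolding image_insert image_empty mapH
  proof (intro equalityI subsetI)
    fix p assume p: "p \<in> vanishing_ideal 2 V"
    then have "p \<in> mpolys 2" by (simp add: vanishing_ideal_def)
    then obtain G where G: "p = mpoly_of_poly2 G" using range_mpoly_of_poly2 by blast
    have "H dvd G" by (rule dvd) (use p G in \<open>auto simp: vanishing_ideal_def\<close>)
    then obtain C where "G = H * C" by blast
    then have "p = mpoly_of_poly2 C * mpoly_of_poly2 H"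
      by (simp add: G mpoly_of_poly2_hom mult.commute)
    then show "p \<in> mpoly_ideal 2 {mpoly_of_poly2 H}"
      unfolding mem_mpoly_ideal_singleton using mpolys_mpoly_of_poly2 by blast
  next
    fix p assume "p \<in> mpoly_ideal 2 {mpoly_of_poly2 H}"
    then obtain c where "c \<in> mpolys 2" "p = c * mpoly_of_poly2 H"
      unfolding mem_mpoly_ideal_singleton by blast
    then show "p \<in> vanishing_ideal 2 V"
      using H_V by (auto simp: vanishing_ideal_def mpolys_mult mpolys_mpoly_of_poly2 mpoly_eval_mult)
  qed
  have nonempty: "V \<noteq> {}"
  proof -
    have "?P \<noteq> 0" using \<alpha>(2) by auto
    then have "finite {x. poly ?P x = 0}" by (rule poly_roots_finite)
    then obtain x where x: "poly ?P x \<noteq> 0"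
      using ex_new_if_finite[OF infinite_UNIV_alg_closed[where 'l = "'k alg_closure"]] by blast
    have "Polynomial.degree (?Q - [:to_ac e / poly ?P x:]) > 0"
      using degQ by (simp add: degree_diff_const)
    then obtain y where "poly (?Q - [:to_ac e / poly ?P x:]) y = 0"
      using alg_closed_imp_poly_has_root by blast
    then have "pt x y \<in> V" unfolding pt using x by simp
    then show ?thesis by blast
  qed
  have irr: "V = A \<or> V = B"
    if A: "algebraic_set 2 A" and B: "algebraic_set 2 B" and AB: "V = A \<union> B" for A B
  proof (rule ccontr)
    assume neither: "\<not> (V = A \<or> V = B)"
    \<comment> \<open>A proper closed subset misses a point of \<open>V\<close>, so one of its
      equations is not a multiple of \<open>H\<close>. For two such subsets covering
      \<open>V\<close> the product of these equations vanishes on \<open>V\<close>, against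
      primality of \<open>H\<close>.\<close>
    have ex: "\<exists>G. (\<forall>x\<in>A. mpoly_eval (mpoly_of_poly2 G) x = 0) \<and> \<not> H dvd G"
      if A: "algebraic_set 2 A" and sub: "A \<subseteq> V" and ne: "V \<noteq> A" for A
    proof -
      obtain S where S: "S \<subseteq> mpolys 2" "A = zero_locus 2 S" using A by (auto simp: algebraic_set_def)
      obtain x where x: "x \<in> V" "x \<notin> A" using sub ne by blast
      then obtain p where p: "p \<in> S" "mpoly_eval p x \<noteq> 0"
        using S(2) V by (auto simp: zero_locus_def)
      obtain G where G: "p = mpoly_of_poly2 G" using p(1) S(1) range_mpoly_of_poly2 by blast
      have "\<not> H dvd G"
      proof
        assume "H dvd G"
        then obtain C where "G = H * C" by blast
        then have "mpoly_eval p x = 0"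
          using H_V[OF x(1)] by (simp add: G mpoly_of_poly2_hom mpoly_eval_mult)
        then show False using p(2) by simp
      qed
      moreover have "\<forall>x\<in>A. mpoly_eval (mpoly_of_poly2 G) x = 0"
        using p(1) S(2) G by (auto simp: zero_locus_def)
      ultimately show ?thesis by blast
    qed
    obtain G1 G2 where G: "\<forall>x\<in>A. mpoly_eval (mpoly_of_poly2 G1) x = 0" "\<not> H dvd G1"
      "\<forall>x\<in>B. mpoly_eval (mpoly_of_poly2 G2) x = 0" "\<not> H dvd G2"
      using ex[OF A] ex[OF B] AB neither by blast
    have "H dvd G1 * G2"
      by (rule dvd) (use G AB in \<open>auto simp: mpoly_of_poly2_hom mpoly_eval_mult\<close>)
    moreover have "prime_elem H"
      unfolding H_def by (rule irreducible_imp_prime_elem, rule irreducible_curve_poly[OF \<alpha> degQ e'])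
    ultimately show False using G(2,4) prime_elem_dvd_mult_iff by blast
  qed
  have "algebraic_set 2 V"
    unfolding algebraic_set_def V_def using mpolys_mpoly_of_poly2 by blast
  then have "irreducible_algebraic_set 2 V"
    unfolding irreducible_algebraic_set_def using nonempty irr by auto
  moreover have "defined_over_base 2 V"
    unfolding defined_over_base_def
    by (rule exI[of _ "{mpoly_of_poly2 ?h}"]) (use ideal mpolys_mpoly_of_poly2 in auto)
  ultimately have "abs_irreducible_variety 2 V"
    by (simp add: abs_irreducible_variety_def)
  then obtain x where x: "x \<in> V" "\<forall>i<2. x i \<in> range to_ac"
    using PAC unfolding pseudo_algebraically_closed_def by meson
  obtain a b where ab: "x 0 = to_ac a" "x 1 = to_ac b"
    using x(2)[rule_format, of 0] x(2)[rule_format, of 1] by auto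
  have "to_ac (poly P a * poly Q b) = to_ac e"
    using x(1) unfolding V ab poly_map_to_ac by simp
  then have "poly P a * poly Q b = e" by (simp only: to_ac_eq_iff)
  then show ?thesis by blast
qed

subsection \<open>Bounds in valued fields\<close>

locale valued_field =
  fixes v :: "'a::field \<Rightarrow> 'g::linordered_ab_group_add"
  assumes val: "valuation v"
begin

abbreviation "\<O> \<equiv> valuation_ring v"
abbreviation "\<mm> \<equiv> valuation_ideal v"

lemmas ring_closed = valuation_ring_closed[OF val]
lemmas ideal_closed = valuation_ideal_closed[OF val]

lemma ring_diff: "x \<in> \<O> \<Longrightarrow> y \<in> \<O> \<Longrightarrow> x - y \<in> \<O>"
  using ring_closed(3)[of y] ring_closed(4)[of x "- y"] by simp

lemma ring_power: "x \<in> \<O> \<Longrightarrow> x ^ n \<in> \<O>"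
  by (induction n) (auto intro: ring_closed)

lemma ring_sum: "(\<And>i. i \<in> I \<Longrightarrow> g i \<in> \<O>) \<Longrightarrow> sum g I \<in> \<O>"
  by (induction I rule: infinite_finite_induct) (auto intro: ring_closed)

lemma ideal_sum: "(\<And>i. i \<in> I \<Longrightarrow> g i \<in> \<mm>) \<Longrightarrow> sum g I \<in> \<mm>"
  by (induction I rule: infinite_finite_induct) (auto intro: ideal_closed)

lemma ring_of_nat: "of_nat n \<in> \<O>"
  by (induction n) (auto intro: ring_closed)

lemma ideal_mult_right: "x \<in> \<mm> \<Longrightarrow> y \<in> \<O> \<Longrightarrow> x * y \<in> \<mm>"
  using ideal_closed(5)[of y x] by (simp add: mult.commute)

lemma one_notin_ideal: "1 \<notin> \<mm>"
  using valuation_one[OF val] by (simp add: valuation_ideal_def)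

lemma valuation_inverse: "x \<noteq> 0 \<Longrightarrow> v (inverse x) = - v x"
proof -
  assume x: "x \<noteq> 0"
  then have "v (x * inverse x) = v x + v (inverse x)"
    using val unfolding valuation_def by (metis nonzero_imp_inverse_nonzero)
  then show ?thesis
    using x valuation_one[OF val] by (simp add: eq_neg_iff_add_eq_0 add.commute)
qed

lemma inverse_in_ideal_iff: "x \<noteq> 0 \<Longrightarrow> inverse x \<in> \<mm> \<longleftrightarrow> x \<notin> \<O>"
  by (auto simp: valuation_ring_def valuation_ideal_def valuation_inverse)

lemma inverse_in_ring_iff: "x \<noteq> 0 \<Longrightarrow> inverse x \<in> \<O> \<longleftrightarrow> x \<notin> \<mm>"
  by (auto simp: valuation_ring_def valuation_ideal_def valuation_inverse)

lemma one_plus_ideal: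
  assumes "x \<in> \<mm>"
  shows "1 + x \<noteq> 0" "inverse (1 + x) \<in> \<O>"
proof -
  have "1 + x \<notin> \<mm>"
    using assms ideal_closed(3)[of x] ideal_closed(4)[of "1 + x" "- x"] one_notin_ideal by auto
  moreover from this show "1 + x \<noteq> 0" using ideal_closed(1) by auto
  ultimately show "inverse (1 + x) \<in> \<O>" using inverse_in_ring_iff by blast
qed

text \<open>A nonzero element of least value serves; dividing by it scales a finite set of
  coefficients into the valuation ring.\<close>

lemma finite_dominating_element:
  assumes "finite C" "c \<in> C" "c \<noteq> 0"
  shows "\<exists>b\<in>C. b \<noteq> 0 \<and> (\<forall>a\<in>C. a / b \<in> \<O>)"
proof -
  have "\<exists>b\<in>C - {0}. \<forall>a\<in>C - {0}. v b \<le> v a"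
    using assms arg_min_if_finite[of "C - {0}" v] by (metis DiffI Diff_iff empty_iff finite_Diff not_le singletonD)
  then obtain b where b: "b \<in> C" "b \<noteq> 0" "\<And>a. a \<in> C \<Longrightarrow> a \<noteq> 0 \<Longrightarrow> v b \<le> v a"
    by blast
  have "a / b \<in> \<O>" if "a \<in> C" for a
  proof (cases "a = 0")
    case False
    have "v (a * inverse b) = v a + v (inverse b)"
      using val False b(2) unfolding valuation_def by (metis nonzero_imp_inverse_nonzero)
    then show ?thesis
      using b(3)[OF that False] b(2) by (simp add: valuation_ring_def valuation_inverse divide_inverse)
  qed (simp add: ring_closed)
  then show ?thesis using b by blast
qed

lemma poly_in_ring:
  assumes "\<And>i. Polynomial.coeff p i \<in> \<O>" "x \<in> \<O>"
  shows "poly p x \<in> \<O>"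
  unfolding poly_altdef using assms by (intro ring_sum ring_closed ring_power)

lemma poly_in_ideal:
  assumes "\<And>i. Polynomial.coeff p i \<in> \<mm>" "x \<in> \<O>"
  shows "poly p x \<in> \<mm>"
  unfolding poly_altdef using assms by (intro ideal_sum ideal_mult_right ring_power)

text \<open>For \<open>b\<close> with \<open>inverse b \<in> \<O>\<close>, the sets \<open>b ^ k \<O>\<close> form an increasing chain.\<close>

definition bounded_by :: "'a \<Rightarrow> nat \<Rightarrow> 'a \<Rightarrow> bool" where
  "bounded_by b k x \<longleftrightarrow> x / b ^ k \<in> \<O>"

lemma bounded_by_0: "bounded_by b k 0"
  by (simp add: bounded_by_def ring_closed)

lemma bounded_by_add: "bounded_by b k x \<Longrightarrow> bounded_by b k y \<Longrightarrow> bounded_by b k (x + y)"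
  by (simp add: bounded_by_def add_divide_distrib ring_closed)

lemma bounded_by_mult: "bounded_by b k x \<Longrightarrow> bounded_by b l y \<Longrightarrow> bounded_by b (k + l) (x * y)"
  unfolding bounded_by_def using ring_closed(5) by (fastforce simp: power_add)

lemma bounded_by_mono:
  assumes "bounded_by b k x" "k \<le> l" "inverse b \<in> \<O>"
  shows "bounded_by b l x"
proof -
  obtain m where l: "l = k + m" using assms(2) le_Suc_ex by blast
  have "x / b ^ k * inverse b ^ m \<in> \<O>"
    using assms by (intro ring_closed ring_power) (simp add: bounded_by_def)
  then show ?thesis by (simp add: bounded_by_def l power_add divide_inverse power_inverse mult.assoc)
qed

text \<open>Each Horner step multiplies by \<open>x\<close>, at the cost of one factor
  \<open>b\<close>. The coefficients of \<open>pcompose p [:x, 1:]\<close> are the Taylor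
  coefficients of \<open>p\<close> at \<open>x\<close>.\<close>

lemma bounded_by_taylor:
  assumes b: "inverse b \<in> \<O>" and x: "bounded_by b 1 x"
    and p: "\<And>i. bounded_by b 1 (Polynomial.coeff p i)" "Polynomial.degree p \<le> n"
  shows "bounded_by b (Suc n) (Polynomial.coeff (pcompose p [:x, 1:]) i)"
  using p
proof (induction p arbitrary: n i)
  case 0
  show ?case by (simp add: bounded_by_0)
next
  case (pCons a p)
  have a: "bounded_by b 1 a" using pCons.prems(1)[of 0] by simp
  have p: "bounded_by b 1 (Polynomial.coeff p i)" for i using pCons.prems(1)[of "Suc i"] by simp
  show ?case
  proof (cases "p = 0")
    case True
    then show ?thesis using a bounded_by_mono[OF a _ b, of "Suc n"]
      by (auto simp: pcompose_pCons coeff_pCons bounded_by_0 split: nat.split)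
  next
    case False
    then obtain m where n: "n = Suc m" and m: "Polynomial.degree p \<le> m"
      using pCons.prems(2) by (cases n) auto
    let ?g = "pcompose p [:x, 1:]"
    have g: "bounded_by b (Suc m) (Polynomial.coeff ?g i)" for i
      by (rule pCons.IH[OF p m])
    have 1: "bounded_by b (Suc n) (x * Polynomial.coeff ?g i)" for i
      using bounded_by_mult[OF x g, of i] n by simp
    have 2: "bounded_by b (Suc n) (Polynomial.coeff ?g i)" for i
      using bounded_by_mono[OF g _ b, of "Suc n"] n by simp
    have 3: "bounded_by b (Suc n) a"
      using bounded_by_mono[OF a _ b, of "Suc n"] by simp
    show ?thesis
      using 1 1[of 0] 2 3 by (auto simp: pcompose_pCons coeff_pCons bounded_by_add split: nat.split)
  qed
qed

lemma bounded_by_poly: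
  assumes "inverse b \<in> \<O>" "bounded_by b 1 x"
    and "\<And>i. bounded_by b 1 (Polynomial.coeff p i)" "Polynomial.degree p \<le> n"
  shows "bounded_by b (Suc n) (poly p x)"
proof -
  have "Polynomial.coeff (pcompose p [:x, 1:]) 0 = poly p x"
    by (simp add: poly_pcompose flip: poly_0_coeff_0)
  then show ?thesis using bounded_by_taylor[OF assms, of 0] by simp
qed

text \<open>For \<open>x\<close> outside \<open>b \<O>\<close> the quotient \<open>b / x\<close>
  lies in the maximal ideal and the leading term dominates: \<open>f x = x ^ n * (1 + m)\<close>
  with \<open>m\<close> in the ideal.\<close>

lemma monic_value_outside:
  assumes b: "inverse b \<in> \<O>" and x: "\<not> bounded_by b 1 x" and monic: "lead_coeff f = 1"
    and f: "\<And>i. bounded_by b 1 (Polynomial.coeff f i)"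
  shows "poly f x \<noteq> 0" "inverse (poly f x) \<in> \<O>"
proof -
  have b0: "b \<noteq> 0" and x0: "x \<noteq> 0" using x by (auto simp: bounded_by_def ring_closed)
  define n where "n = Polynomial.degree f"
  have bx: "b / x \<in> \<mm>"
    using x inverse_in_ideal_iff[of "x / b"] b0 x0 by (simp add: bounded_by_def)
  have "b / x * inverse b \<in> \<mm>" by (rule ideal_mult_right[OF bx b])
  then have ix: "inverse x \<in> \<O>" using b0 ideal_closed(2) by (simp add: field_simps)
  define m where "m = (\<Sum>i<n. Polynomial.coeff f i * inverse x ^ (n - i))"
  have m: "m \<in> \<mm>"
    unfolding m_def
  proof (rule ideal_sum)
    fix i assume i: "i \<in> {..<n}"
    then obtain j where j: "n - i = Suc j" by (metis Suc_diff_Suc lessThan_iff)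
    have "(b / x) * (Polynomial.coeff f i / b * inverse x ^ j) \<in> \<mm>"
      using f[of i] by (intro ideal_mult_right[OF bx] ring_closed ring_power ix)
        (simp add: bounded_by_def)
    then show "Polynomial.coeff f i * inverse x ^ (n - i) \<in> \<mm>"
      unfolding j using b0 x0 by (simp add: field_simps)
  qed
  have "poly f x = (\<Sum>i<n. Polynomial.coeff f i * x ^ i) + x ^ n"
    using monic unfolding poly_altdef n_def
    by (simp add: lessThan_Suc_atMost[symmetric])
  also have "(\<Sum>i<n. Polynomial.coeff f i * x ^ i) = x ^ n * m"
    unfolding m_def sum_distrib_left
  proof (rule sum.cong[OF refl])
    fix i assume "i \<in> {..<n}"
    then have "x ^ n = x ^ (n - i) * x ^ i" by (simp flip: power_add)
    then show "Polynomial.coeff f i * x ^ i = x ^ n * (Polynomial.coeff f i * inverse x ^ (n - i))"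
      using x0 by (simp add: power_inverse field_simps)
  qed
  finally have fx: "poly f x = x ^ n * (1 + m)" by (simp add: algebra_simps)
  show "poly f x \<noteq> 0" using fx x0 one_plus_ideal(1)[OF m] by simp
  have "inverse x ^ n * inverse (1 + m) \<in> \<O>"
    by (intro ring_closed ring_power ix one_plus_ideal(2) m)
  then show "inverse (poly f x) \<in> \<O>" unfolding fx by (simp add: power_inverse)
qed

text \<open>
  Newton's form of Hensel's lemma: if \<open>f x\<close> were too small, then \<open>t \<mapsto> f (x + t f x / f' x) / f x\<close>
  would be a polynomial over \<open>\<O>\<close> congruent to \<open>1 + t\<close>, and its zero near \<open>-1\<close> would give a zero
  of \<open>f\<close>. The Bezout identity keeps \<open>f' x\<close> away from \<open>0\<close>.
\<close>

lemma inverse_values_bounded: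
  assumes hens: "henselian v" and b: "inverse b \<in> \<O>" "b \<noteq> 0" and monic: "lead_coeff f = 1"
    and f: "\<And>i. bounded_by b 1 (Polynomial.coeff f i)" "Polynomial.degree f \<le> N"
    and A: "\<And>i. bounded_by b 1 (Polynomial.coeff A i)" "Polynomial.degree A \<le> N"
    and B: "\<And>i. bounded_by b 1 (Polynomial.coeff B i)" "Polynomial.degree B \<le> N"
    and bezout: "\<And>x. poly A x * poly f x + poly B x * poly (pderiv f) x = 1"
    and no_root: "\<And>x. poly f x \<noteq> 0"
  shows "bounded_by b (3 * Suc N) (inverse (poly f x))"
proof (cases "bounded_by b 1 x")
  case False
  then have "bounded_by b 0 (inverse (poly f x))"
    using monic_value_outside(2)[OF b(1) False monic f(1)] by (simp add: bounded_by_def)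
  then show ?thesis by (rule bounded_by_mono) (use b in auto)
next
  case True
  \<comment> \<open>\<open>c\<close> bounds the values of \<open>A\<close> and \<open>B\<close> at
    \<open>x\<close> and all Taylor coefficients of \<open>f\<close> at \<open>x\<close>. The
    exponent 3 in the claim comes from the quadratic coefficient of \<open>g\<close> below: one
    factor \<open>c\<close> for the Taylor coefficient and two for the division by
    \<open>w ^ 2\<close>.\<close>
  define c where "c = b ^ Suc N"
  have c0: "c \<noteq> 0" and ic: "inverse c \<in> \<O>"
    using b ring_power[OF b(1)] by (auto simp: c_def power_inverse simp del: power_Suc)
  define u where "u = poly f x"
  define w where "w = poly (pderiv f) x"
  have u0: "u \<noteq> 0" unfolding u_def by (rule no_root)
  show ?thesis
  proof (rule ccontr)
    assume neg: "\<not> ?thesis"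
    have c3: "b ^ (3 * Suc N) = c ^ 3" unfolding c_def by (metis mult.commute power_mult)
    have "inverse u / c ^ 3 \<notin> \<O>"
      using neg unfolding bounded_by_def c3 u_def .
    then have uc: "u * c ^ 3 \<in> \<mm>"
      using inverse_in_ideal_iff[of "inverse u / c ^ 3"] u0 c0 by (simp add: field_simps)
    have Ax: "poly A x / c \<in> \<O>" and Bx: "poly B x / c \<in> \<O>"
      using bounded_by_poly[OF b(1) True A] bounded_by_poly[OF b(1) True B]
      unfolding bounded_by_def c_def by auto
    define q where "q = pcompose f [:x, 1:]"
    have q: "Polynomial.coeff q i / c \<in> \<O>" for i
      using bounded_by_taylor[OF b(1) True f] unfolding bounded_by_def c_def q_def by auto
    have q0: "Polynomial.coeff q 0 = u"
      unfolding q_def u_def by (simp add: poly_pcompose flip: poly_0_coeff_0)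
    have q1: "Polynomial.coeff q 1 = w"
    proof -
      have "Polynomial.coeff q 1 = poly (pderiv q) 0" by (simp add: poly_0_coeff_0 coeff_pderiv)
      also have "pderiv q = pcompose (pderiv f) [:x, 1:]"
        unfolding q_def by (simp add: pderiv_pcompose pderiv_pCons)
      finally show ?thesis by (simp add: poly_pcompose w_def)
    qed
    \<comment> \<open>Since \<open>u * c ^ 3\<close> is small, so is \<open>A x * u\<close>. The
      Bezout identity then makes \<open>B x * w\<close> a unit \<open>1 + m\<close>, and the bound
      on \<open>B x\<close> becomes one on the inverse of \<open>w\<close>.\<close>
    define m where "m = - (poly A x / c * (inverse c ^ 2 * (u * c ^ 3)))"
    have m: "m \<in> \<mm>" unfolding m_def by (intro ideal_closed Ax ring_power ic uc)
    have "m = - (poly A x * u)"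
      unfolding m_def using c0 by (simp add: field_simps power2_eq_square power3_eq_cube)
    then have Bw: "poly B x * w = 1 + m"
      using bezout[of x] unfolding u_def w_def by (simp add: algebra_simps)
    have w0: "w \<noteq> 0" and B0: "poly B x \<noteq> 0" using Bw one_plus_ideal(1)[OF m] by auto
    have "poly B x / c * inverse (1 + m) \<in> \<O>"
      by (intro ring_closed Bx one_plus_ideal m)
    moreover have "poly B x / c * inverse (1 + m) = inverse (c * w)"
      using w0 B0 c0 unfolding Bw[symmetric] by (simp add: field_simps)
    ultimately have icw: "inverse (c * w) \<in> \<O>" by simp
    define g where "g = Polynomial.smult (inverse u) (pcompose q [:0, u / w:])"
    have coeff_g: "Polynomial.coeff g i = inverse u * ((u / w) ^ i * Polynomial.coeff q i)" for i
      unfolding g_def by (simp add: coeff_pcompose_linear)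
    define h where "h = g - [:1, 1:]"
    have h: "Polynomial.coeff h i \<in> \<mm>" for i
    proof -
      consider "i = 0" | "i = 1" | j where "i = Suc (Suc j)"
        by (metis One_nat_def not0_implies_Suc)
      then show ?thesis
      proof cases
        case 1
        then show ?thesis using u0 by (simp add: h_def coeff_g q0 ideal_closed)
      next
        case 2
        then have "Polynomial.coeff h i = 0" using u0 w0 q1 by (simp add: h_def coeff_g)
        then show ?thesis by (simp add: ideal_closed)
      next
        case (3 j)
        \<comment> \<open>The coefficient \<open>u ^ (i - 1) * coeff q i / w ^ i\<close> of
          \<open>g\<close> with i = j + 2, regrouped into integral factors and one factor in the
          ideal. The exponents of \<open>c\<close> add up to - 1 - (j + 2) - 2 j + 3 j + 3 =
          0.\<close>
        have "(Polynomial.coeff q i / c * (inverse (c * w) ^ Suc (Suc j) * inverse c ^ (2 * j) *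
            (u * c ^ 3) ^ j)) * (u * c ^ 3) \<in> \<mm>"
          by (rule ideal_closed(5)[OF ring_closed(5)[OF q ring_closed(5)[OF ring_closed(5)
            [OF ring_power[OF icw] ring_power[OF ic]] ring_power[OF ideal_closed(2)[OF uc]]]] uc])
        moreover have "(Polynomial.coeff q i / c * (inverse (c * w) ^ Suc (Suc j) * inverse c ^ (2 * j) *
            (u * c ^ 3) ^ j)) * (u * c ^ 3) = inverse u * ((u / w) ^ i * Polynomial.coeff q i)"
        proof -
          obtain cj uj wj where pows: "c ^ j = cj" "u ^ j = uj" "w ^ j = wj" by blast
          then have nz: "cj \<noteq> 0" "uj \<noteq> 0" "wj \<noteq> 0" using c0 u0 w0 by auto
          have 1: "inverse (c * w) ^ Suc (Suc j) = inverse (c * w) * inverse (c * w) * inverse (cj * wj)"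
            by (simp add: power_mult_distrib power_inverse flip: pows)
          have 2: "inverse c ^ (2 * j) = inverse (cj * cj)"
            by (simp add: power_inverse mult_2 power_add flip: pows)
          have 3: "(u * c ^ 3) ^ j = uj * (cj * cj * cj)"
            by (simp add: power_mult_distrib power3_eq_cube flip: pows)
          have 4: "(u / w) ^ i = u * u * uj / (w * w * wj)"
            by (simp add: \<open>i = Suc (Suc j)\<close> power_divide mult.assoc flip: pows)
          show ?thesis
            unfolding 1 2 3 4 using c0 u0 w0 nz by (simp add: field_simps power3_eq_cube)
        qed
        ultimately have "inverse u * ((u / w) ^ i * Polynomial.coeff q i) \<in> \<mm>" by simp
        then show ?thesis by (simp add: h_def coeff_g 3)
      qed
    qed
    have g: "g = [:1, 1:] + h" by (simp add: h_def)
    have m1: "- 1 \<in> \<O>" by (intro ring_closed)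
    have "Polynomial.coeff g i \<in> \<O>" for i
      unfolding g using h[of i] ideal_closed(2) ring_closed
      by (auto simp: coeff_pCons split: nat.split)
    moreover have "poly g (- 1) \<in> \<mm>"
      unfolding g using poly_in_ideal[OF h m1] by simp
    moreover have "poly (pderiv g) (- 1) \<notin> \<mm>"
    proof
      assume *: "poly (pderiv g) (- 1) \<in> \<mm>"
      have "Polynomial.coeff (pderiv h) i \<in> \<mm>" for i
        unfolding coeff_pderiv by (intro ideal_closed(5) ring_of_nat h)
      then have "poly (pderiv h) (- 1) \<in> \<mm>" by (rule poly_in_ideal[OF _ m1])
      then have "1 + poly (pderiv h) (- 1) \<noteq> 0" "inverse (1 + poly (pderiv h) (- 1)) \<in> \<O>"
        by (rule one_plus_ideal)+
      moreover have "poly (pderiv g) (- 1) = 1 + poly (pderiv h) (- 1)"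
        unfolding g by (simp add: pderiv_add pderiv_pCons)
      ultimately show False using * inverse_in_ring_iff by auto
    qed
    ultimately obtain t where t: "poly g t = 0"
      using hens m1 unfolding henselian_def by blast
    then have "poly f (x + u / w * t) = 0"
      using u0 unfolding g_def q_def by (simp add: poly_pcompose mult.commute)
    then show False using no_root by blast
  qed
qed

text \<open>The set \<open>S f\<close> of the overview. The first summand leaves room to avoid
  finitely many exceptional values of the difference, and it is the one corrected by Hensel's
  lemma.\<close>

definition value_differences :: "'a poly \<Rightarrow> 'a set" where
  "value_differences f =
     {inverse (poly f x) + inverse (poly f y) - inverse (poly f z) | x y z. True}"

text \<open>The bound \<open>d\<close> is a power of the largest nonzero coefficient
  \<open>b\<close> of \<open>f\<close>, \<open>A\<close> and \<open>B\<close>. As \<open>b\<close>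
  lies in \<open>S\<close>, so do \<open>d\<close> and \<open>d * d\<close>. Vanishing coefficients
  are covered by \<open>S \<union> {0}\<close>, as 0 is not assumed to lie in
  \<open>S\<close>.\<close>

lemma value_differences_subset_ring:
  assumes hens: "henselian v" and monic: "lead_coeff f = 1"
    and coeffs: "\<And>i. Polynomial.coeff f i \<in> S \<union> {0}" "\<And>i. Polynomial.coeff A i \<in> S \<union> {0}"
      "\<And>i. Polynomial.coeff B i \<in> S \<union> {0}"
    and bezout: "\<And>x. poly A x * poly f x + poly B x * poly (pderiv f) x = 1"
    and no_root: "\<And>x. poly f x \<noteq> 0"
    and S: "S = value_differences f"
    and mult: "\<And>s t. s \<in> S \<Longrightarrow> t \<in> S \<Longrightarrow> s * t \<in> S"
  shows "S \<subseteq> \<O>"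
proof -
  define C where "C = (\<Union>p\<in>{f, A, B}. Polynomial.coeff p ` {..Polynomial.degree p}) - {0}"
  have "finite C" by (simp add: C_def)
  \<comment> \<open>Since \<open>f\<close> is monic, 1 is among the coefficients dominated by
    \<open>b\<close>, so \<open>inverse b\<close> is integral and the sets \<open>b ^ k \<O>\<close>
    increase.\<close>
  moreover have "1 \<in> C" using monic unfolding C_def by (auto intro!: image_eqI[of 1 _ "Polynomial.degree f"])
  ultimately obtain b where b: "b \<in> C" "b \<noteq> 0" "\<And>a. a \<in> C \<Longrightarrow> a / b \<in> \<O>"
    using finite_dominating_element[of C 1] by auto
  have ib: "inverse b \<in> \<O>" using b(3)[OF \<open>1 \<in> C\<close>] by (simp add: divide_inverse)
  have bnd: "bounded_by b 1 (Polynomial.coeff p i)" if "p \<in> {f, A, B}" for p i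
  proof (cases "Polynomial.coeff p i = 0")
    case False
    then have "Polynomial.coeff p i \<in> C"
      using that le_degree[OF False] unfolding C_def by blast
    then show ?thesis using b(3) by (simp add: bounded_by_def)
  qed (simp add: bounded_by_0)
  define N where "N = Polynomial.degree f + Polynomial.degree A + Polynomial.degree B"
  define d where "d = b ^ (3 * Suc N)"
  have inv: "inverse (poly f x) / d \<in> \<O>" for x
    using inverse_values_bounded[OF hens ib b(2) monic, of N A B x] bnd bezout no_root
    unfolding N_def d_def bounded_by_def by auto
  have Sd: "s / d \<in> \<O>" if "s \<in> S" for s
  proof -
    obtain x y z where "s = inverse (poly f x) + inverse (poly f y) - inverse (poly f z)"
      using \<open>s \<in> S\<close> unfolding S value_differences_def by blast
    then have "s / d = inverse (poly f x) / d + inverse (poly f y) / d - inverse (poly f z) / d"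
      by (simp add: add_divide_distrib diff_divide_distrib)
    also have "\<dots> \<in> \<O>" by (intro ring_diff ring_closed inv)
    finally show ?thesis .
  qed
  have bS: "b \<in> S" using b(1) coeffs unfolding C_def by blast
  have "b ^ Suc k \<in> S" for k
    by (induction k) (use bS mult in auto)
  then have dS: "d \<in> S" unfolding d_def by (metis mult_Suc_right numeral_3_eq_3 add_Suc)
  have d0: "d \<noteq> 0" using b(2) by (simp add: d_def)
  have "d * d / d \<in> \<O>" by (rule Sd[OF mult[OF dS dS]])
  then have d: "d \<in> \<O>" using d0 by simp
  show ?thesis
  proof
    fix s assume "s \<in> S"
    then have "s / d * d \<in> \<O>" using Sd d by (intro ring_closed)
    then show "s \<in> \<O>" using d0 by simp
  qed
qed

end

subsection \<open>Bezout identities over the valuation ring\<close>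

text \<open>A nonzero combination of least degree divides every combination, since the remainder
  would be one of smaller degree.\<close>

lemma field_poly_bezout:
  fixes p q :: "'f::field poly"
  assumes "p \<noteq> 0"
  shows "\<exists>A B d. d \<noteq> 0 \<and> A * p + B * q = d \<and> d dvd p \<and> d dvd q"
proof -
  define I where "I = {d. d \<noteq> 0 \<and> (\<exists>A B. d = A * p + B * q)}"
  have "p = 1 * p + 0 * q" by simp
  then have "p \<in> I" using assms unfolding I_def by blast
  then obtain d where d: "d \<in> I" "\<And>e. e \<in> I \<Longrightarrow> Polynomial.degree d \<le> Polynomial.degree e"
    using ex_has_least_nat[of "\<lambda>d. d \<in> I" p Polynomial.degree] by blast
  then obtain A B where AB: "d = A * p + B * q" and d0: "d \<noteq> 0" unfolding I_def by blast
  have dvd: "d dvd s" if s: "s = C * p + D * q" for s C D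
  proof (rule ccontr)
    assume "\<not> d dvd s"
    then have m: "s mod d \<noteq> 0" by (simp add: dvd_eq_mod_eq_0)
    have "s mod d = s - s div d * d" by (simp add: minus_div_mult_eq_mod)
    also have "\<dots> = (C - s div d * A) * p + (D - s div d * B) * q"
      unfolding s AB by (simp add: algebra_simps)
    finally have "s mod d \<in> I" using m unfolding I_def by blast
    then show False using d(2) degree_mod_less'[OF d0 m] by (metis not_le)
  qed
  have "d dvd p" by (rule dvd[of _ 1 0]) simp
  moreover have "d dvd q" by (rule dvd[of _ 0 1]) simp
  ultimately show ?thesis using d0 AB by metis
qed

section \<open>Reduction of polynomials along the residue map\<close>

locale residue_valued_field = valued_field v
  for v :: "'a::field \<Rightarrow> 'g::linordered_ab_group_add" +
  fixes r :: "'a \<Rightarrow> 'k::field"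
  assumes res: "residue_map v r"
begin

lemma res_1: "r 1 = 1"
  and res_add: "x \<in> \<O> \<Longrightarrow> y \<in> \<O> \<Longrightarrow> r (x + y) = r x + r y"
  and res_mult: "x \<in> \<O> \<Longrightarrow> y \<in> \<O> \<Longrightarrow> r (x * y) = r x * r y"
  and res_surj: "r ` \<O> = UNIV"
  and res_eq_0_iff: "x \<in> \<O> \<Longrightarrow> r x = 0 \<longleftrightarrow> x \<in> \<mm>"
  using res unfolding residue_map_def by auto

lemma res_0: "r 0 = 0"
  using res_eq_0_iff[of 0] ring_closed(1) ideal_closed(1) by simp

lemma res_minus: "x \<in> \<O> \<Longrightarrow> r (- x) = - r x"
  using res_add[of x "- x"] ring_closed(3)[of x] res_0 by (simp add: eq_neg_iff_add_eq_0 add.commute)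

lemma res_diff: "x \<in> \<O> \<Longrightarrow> y \<in> \<O> \<Longrightarrow> r (x - y) = r x - r y"
  using res_add[of x "- y"] ring_closed(3)[of y] by (simp add: res_minus)

lemma res_of_nat: "r (of_nat n) = of_nat n"
  by (induction n) (simp_all add: res_0 res_1 res_add ring_of_nat ring_closed)

lemma res_sum: "(\<And>i. i \<in> I \<Longrightarrow> g i \<in> \<O>) \<Longrightarrow> r (sum g I) = (\<Sum>i\<in>I. r (g i))"
  by (induction I rule: infinite_finite_induct) (simp_all add: res_0 res_add ring_sum)

lemma res_inverse:
  assumes "x \<in> \<O>" "r x \<noteq> 0"
  shows "inverse x \<in> \<O>" "r (inverse x) = inverse (r x)"
proof -
  have x: "x \<notin> \<mm>" "x \<noteq> 0" using assms res_eq_0_iff res_0 by auto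
  then show 1: "inverse x \<in> \<O>" using inverse_in_ring_iff by blast
  have "r (x * inverse x) = r x * r (inverse x)" by (rule res_mult[OF assms(1) 1])
  then show "r (inverse x) = inverse (r x)"
    using x assms(2) res_1 by (simp add: field_simps)
qed

definition integral_poly :: "'a poly \<Rightarrow> bool" where
  "integral_poly p \<longleftrightarrow> (\<forall>i. Polynomial.coeff p i \<in> \<O>)"

lemma coeff_res_poly: "Polynomial.coeff (map_poly r p) i = r (Polynomial.coeff p i)"
  by (simp add: coeff_map_poly res_0)

lemma res_poly:
  assumes "integral_poly p" "x \<in> \<O>"
  shows "r (poly p x) = poly (map_poly r p) (r x)"
  using assms(1)
proof (induction p)
  case (pCons a p)
  then have a: "a \<in> \<O>" and p: "integral_poly p"
    unfolding integral_poly_def by (metis coeff_pCons_0, metis coeff_pCons_Suc)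
  have "poly p x \<in> \<O>" using p assms(2) by (simp add: integral_poly_def poly_in_ring)
  then show ?case
    using a p pCons.IH assms(2) by (simp add: map_poly_pCons res_0 res_add res_mult ring_closed)
qed (simp add: res_0)

lemma integral_poly_mult: "integral_poly p \<Longrightarrow> integral_poly q \<Longrightarrow> integral_poly (p * q)"
  unfolding integral_poly_def coeff_mult by (auto intro!: ring_sum ring_closed)

lemma integral_poly_pderiv: "integral_poly p \<Longrightarrow> integral_poly (pderiv p)"
  unfolding integral_poly_def coeff_pderiv by (intro allI ring_closed(5) ring_of_nat) auto

lemma res_poly_mult:
  assumes "integral_poly p" "integral_poly q"
  shows "map_poly r (p * q) = map_poly r p * map_poly r q"
proof (rule poly_eqI)
  fix n
  have "r (\<Sum>i\<le>n. Polynomial.coeff p i * Polynomial.coeff q (n - i)) =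
      (\<Sum>i\<le>n. r (Polynomial.coeff p i * Polynomial.coeff q (n - i)))"
    using assms unfolding integral_poly_def by (intro res_sum ring_closed(5)) auto
  then show "Polynomial.coeff (map_poly r (p * q)) n = Polynomial.coeff (map_poly r p * map_poly r q) n"
    using assms unfolding coeff_res_poly coeff_mult integral_poly_def by (simp add: res_mult)
qed

lemma res_poly_add:
  assumes "integral_poly p" "integral_poly q"
  shows "map_poly r (p + q) = map_poly r p + map_poly r q"
  using assms by (intro poly_eqI) (simp add: coeff_res_poly integral_poly_def res_add)

lemma res_poly_pderiv:
  assumes "integral_poly p"
  shows "map_poly r (pderiv p) = pderiv (map_poly r p)"
proof (rule poly_eqI)
  fix n
  have "r (of_nat (Suc n) * Polynomial.coeff p (Suc n)) = of_nat (Suc n) * r (Polynomial.coeff p (Suc n))"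
    using assms ring_of_nat unfolding integral_poly_def by (subst res_mult) (simp_all only: res_of_nat)
  then show "Polynomial.coeff (map_poly r (pderiv p)) n = Polynomial.coeff (pderiv (map_poly r p)) n"
    by (simp only: coeff_res_poly coeff_pderiv)
qed

text \<open>A section of the residue map is applied coefficientwise. Sending 0 to 0 and 1 to 1 makes
  it preserve the degree and a leading coefficient 1.\<close>

lemma ex_integral_lift:
  fixes p :: "'k poly"
  shows "\<exists>q. integral_poly q \<and> map_poly r q = p \<and> Polynomial.degree q = Polynomial.degree p \<and>
    (lead_coeff p = 1 \<longrightarrow> lead_coeff q = 1)"
proof -
  define s where "s c = (if c = 0 then 0 else if c = 1 then 1 else SOME x. x \<in> \<O> \<and> r x = c)" for c :: 'k
  have s: "s c \<in> \<O> \<and> r (s c) = c" for c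
  proof -
    have "\<exists>x. x \<in> \<O> \<and> r x = c" using res_surj by (metis UNIV_I imageE)
    then have "(SOME x. x \<in> \<O> \<and> r x = c) \<in> \<O> \<and> r (SOME x. x \<in> \<O> \<and> r x = c) = c"
      by (rule someI_ex)
    then show ?thesis by (simp add: s_def res_0 res_1 ring_closed)
  qed
  have s0: "s 0 = 0" and s1: "s 1 = 1" by (simp_all add: s_def)
  define q where "q = map_poly s p"
  have coeff: "Polynomial.coeff q i = s (Polynomial.coeff p i)" for i
    unfolding q_def by (simp add: coeff_map_poly s0)
  have deg: "Polynomial.degree q = Polynomial.degree p"
    unfolding q_def by (rule degree_map_poly) (use s res_0 in metis)
  have "map_poly r q = p" by (rule poly_eqI) (simp add: coeff_res_poly coeff s)
  then show ?thesis using deg by (intro exI[of _ q]) (simp add: integral_poly_def coeff s s1)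
qed

text \<open>
  Dividing a Bezout relation by its largest coefficient gives a nontrivial relation over the
  residue field, which forces the right-hand side to be that large.
\<close>

lemma bezout_coefficients_integral:
  assumes f: "integral_poly f" and irr: "Factorial_Ring.irreducible (map_poly r f)"
    and sep: "pderiv (map_poly r f) \<noteq> 0"
    and deg: "Polynomial.degree (map_poly r f) = Polynomial.degree f"
    and AB: "A * f + B * pderiv f = [:c:]" "A \<noteq> 0 \<or> B \<noteq> 0" "Polynomial.degree B < Polynomial.degree f"
  shows "c \<noteq> 0 \<and> (\<forall>i. Polynomial.coeff A i / c \<in> \<O> \<and> Polynomial.coeff B i / c \<in> \<O>)"
proof -
  define C where "C = Polynomial.coeff A ` {..Polynomial.degree A} \<union> Polynomial.coeff B ` {..Polynomial.degree B}"
  have "lead_coeff A \<in> C" "lead_coeff B \<in> C" by (auto simp: C_def)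
  then have "\<exists>a\<in>C. a \<noteq> 0" using AB(2) leading_coeff_0_iff by metis
  then obtain a where "a \<in> C" "a \<noteq> 0" by blast
  moreover have "finite C" by (simp add: C_def)
  ultimately obtain b where b: "b \<in> C" "b \<noteq> 0" "\<forall>a\<in>C. a / b \<in> \<O>"
    using finite_dominating_element by blast
  define A' where "A' = Polynomial.smult (inverse b) A"
  define B' where "B' = Polynomial.smult (inverse b) B"
  have coeffs: "Polynomial.coeff p i / b \<in> \<O>" if "p = A \<or> p = B" for p i
  proof (cases "Polynomial.coeff p i = 0")
    case False
    then show ?thesis using that le_degree[OF False] b(3) unfolding C_def by blast
  qed (simp add: ring_closed)
  then have int: "integral_poly A'" "integral_poly B'"
    unfolding integral_poly_def A'_def B'_def
    by (auto simp: divide_inverse mult.commute)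
  obtain p i where pi: "p = A \<or> p = B" "Polynomial.coeff p i = b" using b(1) unfolding C_def by blast
  have int_f': "integral_poly (pderiv f)" by (rule integral_poly_pderiv[OF f])
  \<comment> \<open>Otherwise the reduced relation has right-hand side 0. The reduction of
    \<open>f\<close> is prime and does not divide its derivative, so it divides the reduction of
    \<open>B'\<close>, which has smaller degree. Thus \<open>B'\<close> and then \<open>A'\<close>
    reduce to 0, although one of them has a coefficient 1.\<close>
  have cb: "c / b \<notin> \<mm>"
  proof
    assume c: "c / b \<in> \<mm>"
    have "A' * f + B' * pderiv f = Polynomial.smult (inverse b) (A * f + B * pderiv f)"
      by (simp add: A'_def B'_def smult_add_right)
    also have "\<dots> = [:c / b:]" unfolding AB(1) by (simp add: divide_inverse mult.commute)
    finally have "map_poly r (A' * f + B' * pderiv f) = map_poly r [:c / b:]" by simp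
    also have "map_poly r [:c / b:] = 0"
      using c res_eq_0_iff ideal_closed(2) by (simp add: map_poly_pCons res_0)
    finally have eq: "map_poly r A' * map_poly r f + map_poly r B' * pderiv (map_poly r f) = 0"
      using int f int_f'
      by (simp add: res_poly_add res_poly_mult integral_poly_mult res_poly_pderiv)
    then have "map_poly r f dvd map_poly r B' * pderiv (map_poly r f)"
      by (metis add_eq_0_iff dvd_minus_iff dvd_triv_right)
    moreover have "\<not> map_poly r f dvd pderiv (map_poly r f)"
    proof
      assume "map_poly r f dvd pderiv (map_poly r f)"
      then have "Polynomial.degree (map_poly r f) \<le> Polynomial.degree (pderiv (map_poly r f))"
        using sep by (rule dvd_imp_degree_le)
      also have "\<dots> \<le> Polynomial.degree (map_poly r f) - 1"
        by (rule degree_le) (auto simp: coeff_pderiv intro!: coeff_eq_0)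
      finally show False using AB(3) deg by simp
    qed
    ultimately have dvd: "map_poly r f dvd map_poly r B'"
      using prime_elem_dvd_multD[OF field_poly_irreducible_imp_prime[OF irr]] by blast
    have "Polynomial.degree (map_poly r B') < Polynomial.degree (map_poly r f)"
      unfolding deg by (rule le_less_trans[OF map_poly_degree_leq]) (use AB(3) b in \<open>simp add: B'_def\<close>)
    then have B0: "map_poly r B' = 0" using dvd dvd_imp_degree_le not_le by blast
    moreover have "map_poly r f \<noteq> 0" using irr by auto
    ultimately have A0: "map_poly r A' = 0" using eq by simp
    have "Polynomial.coeff A' i = 1 \<or> Polynomial.coeff B' i = 1"
      using pi b(2) by (auto simp: A'_def B'_def)
    then show False
      using A0 B0 coeff_res_poly[of A' i] coeff_res_poly[of B' i] res_1 by auto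
  qed
  then have c0: "c \<noteq> 0" using ideal_closed(1) by auto
  have bc: "b / c \<in> \<O>"
    using cb inverse_in_ring_iff[of "c / b"] c0 b(2) by (simp add: field_simps)
  have "Polynomial.coeff p i / c \<in> \<O>" if "p = A \<or> p = B" for p i
  proof -
    have "Polynomial.coeff p i / b * (b / c) \<in> \<O>" by (rule ring_closed(5)[OF coeffs[OF that] bc])
    then show ?thesis using b(2) by simp
  qed
  then show ?thesis using c0 by blast
qed

text \<open>A nonconstant common divisor \<open>d\<close> over the field, with
  \<open>f = d * h\<close> and \<open>pderiv f = d * k\<close>, would give the relation
  \<open>k * f - h * pderiv f = 0\<close>, excluded by the previous lemma for \<open>c = 0\<close>.
  So there is a relation with right-hand side 1, and the same lemma shows that its coefficients are
  integral.\<close>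

lemma ex_integral_bezout:
  assumes f: "integral_poly f" and irr: "Factorial_Ring.irreducible (map_poly r f)"
    and sep: "pderiv (map_poly r f) \<noteq> 0"
    and deg: "Polynomial.degree (map_poly r f) = Polynomial.degree f"
  shows "\<exists>A B. integral_poly A \<and> integral_poly B \<and> A * f + B * pderiv f = 1"
proof -
  have deg0: "Polynomial.degree f > 0"
    using sep deg by (metis degree_eq_zeroE gr0I pderiv_singleton)
  then have f0: "f \<noteq> 0" by auto
  obtain A B d where d: "d \<noteq> 0" "A * f + B * pderiv f = d" "d dvd f" "d dvd pderiv f"
    using field_poly_bezout[OF f0] by blast
  have "Polynomial.degree d = 0"
  proof (rule ccontr)
    assume dd: "Polynomial.degree d \<noteq> 0"
    obtain h k where hk: "f = d * h" "pderiv f = d * k" using d by blast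
    have h0: "h \<noteq> 0" using hk f0 by auto
    have "Polynomial.degree f = Polynomial.degree d + Polynomial.degree h"
      unfolding hk(1) using d(1) h0 by (rule degree_mult_eq)
    then have "Polynomial.degree (- h) < Polynomial.degree f" using dd by simp
    moreover have "k * f = h * pderiv f"
      by (subst hk(1), subst hk(2)) (simp add: ac_simps)
    then have "k * f + (- h) * pderiv f = [:0:]" by simp
    ultimately show False
      using bezout_coefficients_integral[OF f irr sep deg, of k "- h" 0] h0 by auto
  qed
  then obtain e where e: "d = [:e:]" by (metis degree_eq_zeroE)
  then have e0: "e \<noteq> 0" using d(1) by auto
  \<comment> \<open>Reducing the second coefficient modulo \<open>f\<close> and moving the quotient
    to the first keeps the relation and achieves the required degree bound.\<close>
  define B1 where "B1 = Polynomial.smult (inverse e) B mod f"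
  define Q where "Q = Polynomial.smult (inverse e) B div f"
  define A1 where "A1 = Polynomial.smult (inverse e) A + Q * pderiv f"
  have "Polynomial.smult (inverse e) B = Q * f + B1" by (simp add: Q_def B1_def)
  then have "A1 * f + B1 * pderiv f = Polynomial.smult (inverse e) (A * f + B * pderiv f)"
    unfolding A1_def by (simp add: smult_add_right algebra_simps)
      (metis (no_types, lifting) distrib_left mult.assoc mult.commute mult_smult_left)
  also have "\<dots> = [:1:]" unfolding d(2) e using e0 by simp
  finally have eq: "A1 * f + B1 * pderiv f = [:1:]" .
  have "Polynomial.degree B1 < Polynomial.degree f"
    using degree_mod_less[OF f0, of "Polynomial.smult (inverse e) B"] deg0 unfolding B1_def by auto
  moreover have "A1 \<noteq> 0 \<or> B1 \<noteq> 0" using eq by auto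
  ultimately have "integral_poly A1 \<and> integral_poly B1"
    using bezout_coefficients_integral[OF f irr sep deg eq] by (simp add: integral_poly_def)
  then show ?thesis using eq by (auto simp: one_pCons)
qed

text \<open>At integral \<open>x\<close> the value reduces to a nonzero element and is a unit;
  elsewhere the leading term dominates, which is \<open>monic_value_outside\<close> with
  \<open>b = 1\<close>.\<close>

lemma no_residue_root_value:
  assumes f: "integral_poly f" and monic: "lead_coeff f = 1"
    and no_root: "\<And>c. poly (map_poly r f) c \<noteq> 0"
  shows "poly f x \<noteq> 0" "inverse (poly f x) \<in> \<O>"
proof -
  have 1: "bounded_by 1 1 y \<longleftrightarrow> y \<in> \<O>" for y by (simp add: bounded_by_def)
  have "poly f x \<noteq> 0 \<and> inverse (poly f x) \<in> \<O>"
  proof (cases "x \<in> \<O>")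
    case True
    then have "r (poly f x) \<noteq> 0" using res_poly[OF f] no_root by simp
    moreover have "poly f x \<in> \<O>" using f True by (simp add: integral_poly_def poly_in_ring)
    ultimately show ?thesis using res_inverse(1) res_0 by auto
  next
    case False
    show ?thesis
      using monic_value_outside[of 1 x f] False monic f ring_closed(2)
      unfolding 1 integral_poly_def by simp
  qed
  then show "poly f x \<noteq> 0" "inverse (poly f x) \<in> \<O>" by auto
qed

text \<open>The residue of \<open>c\<close> is represented over the residue field. Lifts of
  \<open>y'\<close> and \<open>z'\<close> are kept, and the error is absorbed in the first term: its
  value must be \<open>u\<close>, and a lift of \<open>x'\<close> is a simple zero of the reduction
  of \<open>f - inverse u\<close>.\<close>

lemma value_differences_eq_ring:
  assumes hens: "henselian v" and f: "integral_poly f" and monic: "lead_coeff f = 1"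
    and no_root: "\<And>c. poly (map_poly r f) c \<noteq> 0"
    and surj: "\<And>c. \<exists>x y z. poly (pderiv (map_poly r f)) x \<noteq> 0 \<and>
      c = inverse (poly (map_poly r f) x) + inverse (poly (map_poly r f) y) - inverse (poly (map_poly r f) z)"
  shows "value_differences f = \<O>"
proof
  note vals = no_residue_root_value[OF f monic no_root]
  show "value_differences f \<subseteq> \<O>"
    unfolding value_differences_def using vals by (auto intro!: ring_diff ring_closed(4))
  show "\<O> \<subseteq> value_differences f"
  proof
    fix c assume c: "c \<in> \<O>"
    obtain x' y' z' where x': "poly (pderiv (map_poly r f)) x' \<noteq> 0"
      and rc: "r c = inverse (poly (map_poly r f) x') + inverse (poly (map_poly r f) y') -
        inverse (poly (map_poly r f) z')"
      using surj by blast
    obtain x y z where xyz: "x \<in> \<O>" "r x = x'" "y \<in> \<O>" "r y = y'" "z \<in> \<O>" "r z = z'"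
      using res_surj by (metis UNIV_I imageE)
    have fO: "poly f t \<in> \<O>" and rf: "r (poly f t) = poly (map_poly r f) (r t)" if "t \<in> \<O>" for t
      using that f res_poly by (auto simp: integral_poly_def poly_in_ring)
    have inv: "r (inverse (poly f t)) = inverse (poly (map_poly r f) (r t))" if "t \<in> \<O>" for t
      using res_inverse(2)[OF fO[OF that]] rf[OF that] no_root by simp
    define u where "u = c - inverse (poly f y) + inverse (poly f z)"
    have u: "u \<in> \<O>" unfolding u_def by (intro ring_closed(4) ring_diff c vals)
    have ru: "r u = inverse (poly (map_poly r f) x')"
      unfolding u_def using xyz c vals
      by (simp add: res_add res_diff ring_diff inv rc)
    then have ru0: "r u \<noteq> 0" using no_root by simp
    then have u0: "u \<noteq> 0" using res_0 by auto
    have iu: "inverse u \<in> \<O>" and riu: "r (inverse u) = poly (map_poly r f) x'"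
      using res_inverse[OF u ru0] ru by auto
    define p where "p = f - [:inverse u:]"
    have "Polynomial.coeff p i \<in> \<O>" for i
      using f iu unfolding p_def integral_poly_def
      by (auto simp: coeff_pCons intro!: ring_diff ring_closed split: nat.split)
    moreover have "poly p x \<in> \<mm>"
    proof -
      have "r (poly p x) = 0" unfolding p_def using xyz fO iu rf riu by (simp add: res_diff)
      then show ?thesis unfolding p_def using res_eq_0_iff xyz fO iu by (simp add: ring_diff)
    qed
    moreover have "poly (pderiv p) x \<notin> \<mm>"
    proof -
      have "integral_poly (pderiv f)" by (rule integral_poly_pderiv[OF f])
      then have "r (poly (pderiv f) x) \<noteq> 0" "poly (pderiv f) x \<in> \<O>"
        using res_poly[of "pderiv f" x] res_poly_pderiv[OF f] x' xyz
        by (auto simp: integral_poly_def poly_in_ring)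
      then show ?thesis using res_eq_0_iff by (simp add: p_def pderiv_diff)
    qed
    ultimately obtain t where "poly p t = 0"
      using hens xyz(1) unfolding henselian_def by blast
    then have "inverse (poly f t) = u" by (simp add: p_def)
    then have "c = inverse (poly f t) + inverse (poly f y) - inverse (poly f z)"
      by (simp add: u_def)
    then show "c \<in> value_differences f" unfolding value_differences_def by blast
  qed
qed

end

subsection \<open>Values of polynomials over pseudo-algebraically closed fields\<close>

text \<open>An irreducible separable polynomial of a separable element outside the ground field,
  made monic. Zero derivative would make every zero multiple; a zero in the ground field would make
  the polynomial linear and the element rational.\<close>

lemma not_separably_closed_polynomial:
  assumes "\<not> separably_closed TYPE('k::field)"
  shows "\<exists>f :: 'k poly. Factorial_Ring.irreducible f \<and> lead_coeff f = 1 \<and> pderiv f \<noteq> 0 \<and>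
    (\<forall>c. poly f c \<noteq> 0)"
proof -
  have "range to_ac \<subseteq> (separable_closure :: 'k alg_closure set)"
  proof
    fix x :: "'k alg_closure" assume "x \<in> range to_ac"
    then obtain a where x: "x = to_ac a" by blast
    have map: "map_poly to_ac [:- a, 1:] = [:- x, 1:]" by (simp add: map_poly_pCons x)
    have "order y [:- x, 1:] \<le> Polynomial.degree [:- x, 1:]" for y
      by (rule order_degree) simp
    then have "separable_poly [:- a, 1:]"
      unfolding separable_poly_def rsquarefree_def map by (auto simp: le_Suc_eq)
    moreover have "Factorial_Ring.irreducible [:- a, 1:]" by (rule irreducible_linear_field_poly) simp
    ultimately show "x \<in> separable_closure" unfolding separable_closure_def using map by auto
  qed
  then obtain x :: "'k alg_closure" where x: "x \<in> separable_closure" "x \<notin> range to_ac"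
    using assms unfolding separably_closed_def by blast
  then obtain p :: "'k poly" where p: "Factorial_Ring.irreducible p" "separable_poly p"
    and px: "poly (map_poly to_ac p) x = 0"
    unfolding separable_closure_def by blast
  have p0: "p \<noteq> 0" using p(1) by auto
  have pderiv_p: "pderiv p \<noteq> 0"
  proof
    assume "pderiv p = 0"
    then have "pderiv (map_poly to_ac p) = 0" by (simp add: pderiv_map_to_ac)
    moreover obtain q where q: "map_poly to_ac p = [:- x, 1:] * q"
      using px by (metis dvdE poly_eq_0_iff_dvd)
    ultimately have "poly ([:- x, 1:] * pderiv q + q * pderiv [:- x, 1:]) x = 0"
      by (metis pderiv_mult poly_0)
    then have "poly q x = 0" by (simp add: pderiv_pCons)
    then obtain s where "q = [:- x, 1:] * s" by (metis dvdE poly_eq_0_iff_dvd)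
    then have "[:- x, 1:] ^ 2 dvd map_poly to_ac p"
      unfolding q by (metis dvd_triv_left mult.assoc power2_eq_square)
    moreover have "map_poly to_ac p \<noteq> 0" using p0 by (simp add: map_poly_eq_0_iff)
    ultimately have "2 \<le> order x (map_poly to_ac p)" by (simp add: order_divides)
    then show False
      using p(2) unfolding separable_poly_def rsquarefree_def by (metis Suc_1 not_less_eq_eq
          numeral_2_eq_2 One_nat_def zero_le le_refl)
  qed
  have no_root: "poly p c \<noteq> 0" for c
  proof
    assume "poly p c = 0"
    then obtain s where s: "p = [:- c, 1:] * s" by (metis dvdE poly_eq_0_iff_dvd)
    have "\<not> is_unit [:- c, 1:]" by (auto simp: is_unit_poly_iff)
    then have "is_unit s" using irreducibleD[OF p(1) s] by blast
    then obtain e where e: "s = [:e:]" by (auto simp: is_unit_poly_iff)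
    have e0: "e \<noteq> 0" using p0 s e by auto
    have "map_poly to_ac [:- c, 1:] = [:- to_ac c, 1:]" by (simp add: map_poly_pCons)
    then have "(x - to_ac c) * to_ac e = 0"
      using px unfolding s map_poly_to_ac_mult e by (simp add: map_poly_pCons algebra_simps)
    then show False using x(2) e0 by auto
  qed
  define f where "f = [:inverse (lead_coeff p):] * p"
  have "Factorial_Ring.irreducible f"
    unfolding f_def using p0 p(1)
    by (subst irreducible_mult_unit_left) (auto simp: is_unit_const_poly_iff dvd_field_iff)
  moreover have "lead_coeff f = 1" using p0 by (simp add: f_def)
  moreover have "pderiv f \<noteq> 0" using p0 pderiv_p by (simp add: f_def pderiv_smult)
  moreover have "poly f c \<noteq> 0" for c using p0 no_root by (simp add: f_def)
  ultimately show ?thesis by blast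
qed

text \<open>If the field were finite, then $Y \prod_a (X - a) = 1$ would be a curve without rational points.\<close>

lemma PAC_infinite:
  assumes PAC: "pseudo_algebraically_closed TYPE('k::field)"
  shows "infinite (UNIV :: 'k set)"
proof
  assume fin: "finite (UNIV :: 'k set)"
  \<comment> \<open>The factor for 0 is left out of \<open>q\<close>, so that
    \<open>[:0, 1:] * q\<close> has derivative \<open>q 0 \<noteq> 0\<close> at 0 and 0 can serve as
    the simple zero.\<close>
  define q :: "'k poly" where "q = (\<Prod>a\<in>UNIV - {0}. [:- a, 1:])"
  have "poly q 0 \<noteq> 0" unfolding q_def using fin by (simp add: poly_prod)
  then have "poly (pderiv ([:0, 1:] * q)) 0 \<noteq> 0"
    unfolding pderiv_mult by (simp add: pderiv_pCons)
  then have "poly (pderiv (map_poly to_ac ([:0, 1:] * q))) (to_ac 0) \<noteq> 0"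
    unfolding pderiv_map_to_ac poly_map_to_ac by simp
  moreover have "poly (map_poly to_ac ([:0, 1:] * q)) (to_ac 0) = 0"
    unfolding poly_map_to_ac by simp
  moreover have "pderiv [:0, 1 :: 'k:] \<noteq> 0" by (simp add: pderiv_pCons)
  ultimately obtain a b where ab: "poly ([:0, 1:] * q) a * poly [:0, 1:] b = 1"
    using PAC_curve_point[OF PAC, of "[:0, 1:] * q" "to_ac 0" "[:0, 1:]" 1] by auto
  have "poly ([:0, 1:] * q) a = 0"
    unfolding q_def using fin by (cases "a = 0") (auto simp: poly_prod)
  then show False using ab by auto
qed

text \<open>Clearing denominators gives the curve P(X) Q(Y) = e with P = f - \<delta>, Q = f +
  \<delta> and e = - \<delta> * \<delta>. The condition on \<delta> says that it is not a critical
  value of \<open>f\<close> over the closure, so \<open>P\<close> has a simple zero.\<close>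

lemma PAC_value_difference:
  fixes f :: "'k::field poly"
  assumes PAC: "pseudo_algebraically_closed TYPE('k)" and sep: "pderiv f \<noteq> 0"
    and no_root: "\<And>c. poly f c \<noteq> 0"
    and \<delta>: "\<delta> \<noteq> 0" "\<And>\<alpha>. poly (map_poly to_ac f) \<alpha> = to_ac \<delta> \<Longrightarrow> poly (pderiv (map_poly to_ac f)) \<alpha> \<noteq> 0"
  shows "\<exists>y z. inverse \<delta> = inverse (poly f y) - inverse (poly f z)"
proof -
  let ?F = "map_poly to_ac f"
  have map: "map_poly to_ac (f - [:c:]) = ?F - [:to_ac c:]" for c
    by (rule poly_eqI) (simp add: coeff_map_poly coeff_pCons split: nat.split)
  have "Polynomial.degree ?F > 0"
    using sep by (metis degree_eq_zeroE degree_map_poly gr0I pderiv_singleton to_ac_eq_0_iff)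
  then have "Polynomial.degree (?F - [:to_ac \<delta>:]) > 0" by (simp add: degree_diff_const)
  then obtain \<alpha> where \<alpha>: "poly (?F - [:to_ac \<delta>:]) \<alpha> = 0" using alg_closed_imp_poly_has_root by blast
  then have "poly (pderiv (?F - [:to_ac \<delta>:])) \<alpha> \<noteq> 0" using \<delta>(2) by (simp add: pderiv_diff)
  moreover have "pderiv (f + [:\<delta>:]) \<noteq> 0" using sep by (simp add: pderiv_add)
  moreover have "- (\<delta> * \<delta>) \<noteq> 0" using \<delta>(1) by simp
  ultimately obtain y z where "poly (f - [:\<delta>:]) y * poly (f + [:\<delta>:]) z = - (\<delta> * \<delta>)"
    using PAC_curve_point[OF PAC, of "f - [:\<delta>:]" \<alpha>] \<alpha> unfolding map by blast
  then have "poly f y * poly f z + \<delta> * poly f y = \<delta> * poly f z"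
    by (simp add: algebra_simps)
  then have "inverse \<delta> = inverse (poly f y) - inverse (poly f z)"
    using \<delta>(1) no_root[of y] no_root[of z] by (simp add: field_simps)
  then show ?thesis by blast
qed

text \<open>There are only finitely many critical values, collected in \<open>D\<close>. In an
  infinite field \<open>x\<close> can be chosen so that \<open>c - inverse (poly f x)\<close> is
  nonzero and its inverse avoids \<open>D\<close>.\<close>

lemma PAC_value_differences:
  fixes f :: "'k::field poly"
  assumes PAC: "pseudo_algebraically_closed TYPE('k)" and sep: "pderiv f \<noteq> 0"
    and no_root: "\<And>c. poly f c \<noteq> 0"
  shows "\<exists>x y z. poly (pderiv f) x \<noteq> 0 \<and>
    c = inverse (poly f x) + inverse (poly f y) - inverse (poly f z)"
proof -
  let ?F = "map_poly to_ac f"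
  define D where "D = {\<delta>. \<exists>\<alpha>. poly ?F \<alpha> = to_ac \<delta> \<and> poly (pderiv ?F) \<alpha> = 0}"
  have "pderiv ?F \<noteq> 0" using sep unfolding pderiv_map_to_ac by (simp add: map_poly_eq_0_iff)
  then have "finite (poly ?F ` {\<alpha>. poly (pderiv ?F) \<alpha> = 0})" by (intro finite_imageI poly_roots_finite)
  then have "finite (to_ac ` D)"
    by (rule finite_subset[rotated]) (auto simp: D_def image_iff, metis)
  then have D: "finite D" using inj_to_ac by (metis finite_imageD inj_on_subset subset_UNIV)
  have nonconst: "Polynomial.degree f > 0"
    using sep by (metis degree_eq_zeroE gr0I pderiv_singleton)
  \<comment> \<open>The polynomials express \<open>c = inverse (poly f x)\<close> and
    \<open>\<delta> * (c - inverse (poly f x)) = 1\<close> with denominators cleared; they are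
    nonzero because \<open>f\<close> is nonconstant and \<open>\<delta> * c - 1\<close> and \<delta>
    never vanish together.\<close>
  define bad where "bad = {x. poly (pderiv f) x = 0} \<union> {x. poly (Polynomial.smult c f - [:1:]) x = 0} \<union>
    (\<Union>\<delta>\<in>D. {x. poly (Polynomial.smult (\<delta> * c - 1) f - [:\<delta>:]) x = 0})"
  have nz: "Polynomial.smult a f - [:b:] \<noteq> 0" if "a \<noteq> 0 \<or> b \<noteq> 0" for a b
  proof (cases "a = 0")
    case False
    then have "Polynomial.degree (Polynomial.smult a f - [:b:]) > 0"
      using nonconst by (simp add: degree_diff_const)
    then show ?thesis by auto
  qed (use that in simp)
  have "\<delta> * c - 1 \<noteq> 0 \<or> \<delta> \<noteq> 0" for \<delta> by auto
  then have "finite bad"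
    unfolding bad_def using D sep
    by (intro finite_UnI finite_UN_I poly_roots_finite nz) auto
  then obtain x where x: "x \<notin> bad" using ex_new_if_finite[OF PAC_infinite[OF PAC]] by blast
  define c' where "c' = c - inverse (poly f x)"
  have fx: "poly f x \<noteq> 0" by (rule no_root)
  have c': "c' \<noteq> 0" using x fx by (auto simp: bad_def c'_def field_simps)
  have "inverse c' \<notin> D"
  proof
    assume D: "inverse c' \<in> D"
    have "c' * poly f x = c * poly f x - 1" unfolding c'_def using fx by (simp add: field_simps)
    then have "poly f x = inverse c' * (c * poly f x - 1)" using c' by (simp add: field_simps)
    then have "poly (Polynomial.smult (inverse c' * c - 1) f - [:inverse c':]) x = 0"
      by (simp add: algebra_simps)
    then show False using x D unfolding bad_def by blast
  qed
  then obtain y z where "inverse (inverse c') = inverse (poly f y) - inverse (poly f z)"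
    using PAC_value_difference[OF PAC sep no_root, of "inverse c'"] c' unfolding D_def by auto
  then have "c = inverse (poly f x) + inverse (poly f y) - inverse (poly f z)"
    by (simp add: c'_def algebra_simps)
  moreover have "poly (pderiv f) x \<noteq> 0" using x by (simp add: bad_def)
  ultimately show ?thesis by blast
qed

subsection \<open>The formula\<close>

primrec power_term :: "ring_term \<Rightarrow> nat \<Rightarrow> ring_term" where
  "power_term t 0 = One"
| "power_term t (Suc n) = Times t (power_term t n)"

primrec nat_term :: "nat \<Rightarrow> ring_term" where
  "nat_term 0 = Zero"
| "nat_term (Suc n) = Plus One (nat_term n)"

primrec poly_term :: "(nat \<Rightarrow> ring_term) \<Rightarrow> ring_term \<Rightarrow> nat \<Rightarrow> ring_term" where
  "poly_term c t 0 = c 0"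
| "poly_term c t (Suc n) = Plus (poly_term c t n) (Times (c (Suc n)) (power_term t (Suc n)))"

lemma term_value_power_term: "term_value e (power_term t n) = term_value e t ^ n"
  by (induction n) simp_all

lemma term_value_nat_term: "term_value e (nat_term n) = of_nat n"
  by (induction n) simp_all

lemma term_value_poly_term:
  "term_value e (poly_term c t n) = poly (\<Sum>i\<le>n. Polynomial.monom (term_value e (c i)) i) (term_value e t)"
  by (induction n) (simp_all add: term_value_power_term poly_monom)

lemma term_vars_power_term: "term_vars (power_term t n) \<subseteq> term_vars t"
  by (induction n) auto

lemma term_vars_nat_term: "term_vars (nat_term n) = {}"
  by (induction n) auto

lemma term_vars_poly_term: "term_vars (poly_term c t n) \<subseteq> (\<Union>i\<le>n. term_vars (c i)) \<union> term_vars t"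
proof (induction n)
  case (Suc n)
  then show ?case using term_vars_power_term[of t "Suc n"] by (auto simp: atMost_Suc)
qed simp

section \<open>Derived connectives\<close>

definition Forall :: "nat \<Rightarrow> ring_formula \<Rightarrow> ring_formula" where
  "Forall i \<phi> = Neg (Exists i (Neg \<phi>))"

definition Imp :: "ring_formula \<Rightarrow> ring_formula \<Rightarrow> ring_formula" where
  "Imp \<phi> \<psi> = Neg (And \<phi> (Neg \<psi>))"

definition Conj :: "ring_formula list \<Rightarrow> ring_formula" where
  "Conj \<phi>s = foldr And \<phi>s (Eq Zero Zero)"

definition Exists_list :: "nat list \<Rightarrow> ring_formula \<Rightarrow> ring_formula" where
  "Exists_list is \<phi> = foldr Exists is \<phi>"

lemma satisfies_Forall: "satisfies e (Forall i \<phi>) \<longleftrightarrow> (\<forall>a. satisfies (e(i := a)) \<phi>)"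
  by (simp add: Forall_def)

lemma satisfies_Imp: "satisfies e (Imp \<phi> \<psi>) \<longleftrightarrow> (satisfies e \<phi> \<longrightarrow> satisfies e \<psi>)"
  by (simp add: Imp_def)

lemma satisfies_Conj: "satisfies e (Conj \<phi>s) \<longleftrightarrow> (\<forall>\<phi>\<in>set \<phi>s. satisfies e \<phi>)"
  by (induction \<phi>s) (simp_all add: Conj_def)

lemma satisfies_Exists_list:
  "satisfies e (Exists_list is \<phi>) \<longleftrightarrow> (\<exists>e'. (\<forall>j. j \<notin> set is \<longrightarrow> e' j = e j) \<and> satisfies e' \<phi>)"
proof (induction "is" arbitrary: e)
  case Nil
  have "e' = e" if "\<forall>j. e' j = e j" for e' using that by auto
  then show ?case by (auto simp: Exists_list_def)
next
  case (Cons i "is")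
  have "satisfies e (Exists_list (i # is) \<phi>) \<longleftrightarrow> (\<exists>a. satisfies (e(i := a)) (Exists_list is \<phi>))"
    by (simp add: Exists_list_def)
  also have "\<dots> \<longleftrightarrow> (\<exists>a e'. (\<forall>j. j \<notin> set is \<longrightarrow> e' j = (e(i := a)) j) \<and> satisfies e' \<phi>)"
    by (simp add: Cons)
  also have "\<dots> \<longleftrightarrow> (\<exists>e'. (\<forall>j. j \<notin> set (i # is) \<longrightarrow> e' j = e j) \<and> satisfies e' \<phi>)"
  proof
    assume "\<exists>e'. (\<forall>j. j \<notin> set (i # is) \<longrightarrow> e' j = e j) \<and> satisfies e' \<phi>"
    then obtain e' where "\<forall>j. j \<notin> set (i # is) \<longrightarrow> e' j = e j" "satisfies e' \<phi>" by blast
    then show "\<exists>a e'. (\<forall>j. j \<notin> set is \<longrightarrow> e' j = (e(i := a)) j) \<and> satisfies e' \<phi>"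
      by (intro exI[of _ "e' i"] exI[of _ e']) auto
  next
    assume "\<exists>a e'. (\<forall>j. j \<notin> set is \<longrightarrow> e' j = (e(i := a)) j) \<and> satisfies e' \<phi>"
    then obtain a e' where "\<forall>j. j \<notin> set is \<longrightarrow> e' j = (e(i := a)) j" "satisfies e' \<phi>" by blast
    then show "\<exists>e'. (\<forall>j. j \<notin> set (i # is) \<longrightarrow> e' j = e j) \<and> satisfies e' \<phi>"
      by (intro exI[of _ e']) auto
  qed
  finally show ?case .
qed

lemma free_vars_simps:
  "free_vars (Forall i \<phi>) = free_vars \<phi> - {i}"
  "free_vars (Imp \<phi> \<psi>) = free_vars \<phi> \<union> free_vars \<psi>"
  "free_vars (Conj \<phi>s) = (\<Union>\<phi>\<in>set \<phi>s. free_vars \<phi>)"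
  "free_vars (Exists_list is \<phi>) = free_vars \<phi> - set is"
proof -
  show "free_vars (Conj \<phi>s) = (\<Union>\<phi>\<in>set \<phi>s. free_vars \<phi>)"
    by (induction \<phi>s) (simp_all add: Conj_def)
  show "free_vars (Exists_list is \<phi>) = free_vars \<phi> - set is"
    by (induction "is") (auto simp: Exists_list_def)
qed (auto simp: Forall_def Imp_def)

text \<open>
  The variables \<open>10 + 3 i\<close>, \<open>11 + 3 i\<close> and \<open>12 + 3 i\<close> hold the coefficients of \<open>f\<close>, \<open>A\<close> and \<open>B\<close>;
  the variables below \<open>10\<close> are the free variable \<open>0\<close> and bound element variables.
\<close>

definition coeff_var :: "nat \<Rightarrow> nat \<Rightarrow> ring_term" where
  "coeff_var k i = Var (10 + k + 3 * i)"

definition env_poly :: "(nat \<Rightarrow> 'a::comm_ring_1) \<Rightarrow> nat \<Rightarrow> nat \<Rightarrow> 'a poly" where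
  "env_poly e k n = (\<Sum>i\<le>n. Polynomial.monom (e (10 + k + 3 * i)) i)"

definition value_term :: "nat \<Rightarrow> nat \<Rightarrow> nat \<Rightarrow> ring_term" where
  "value_term k n j = poly_term (coeff_var k) (Var j) n"

text \<open>The sum runs up to \<open>n\<close> with top coefficient 0 rather than to
  \<open>n - 1\<close>, so that \<open>n = 0\<close> needs no separate treatment.\<close>

definition pderiv_term :: "nat \<Rightarrow> nat \<Rightarrow> ring_term" where
  "pderiv_term n j =
     poly_term (\<lambda>i. Times (nat_term (Suc i)) (if i < n then coeff_var 0 (Suc i) else Zero)) (Var j) n"

lemma term_value_value_term: "term_value e (value_term k n j) = poly (env_poly e k n) (e j)"
  by (simp add: value_term_def term_value_poly_term env_poly_def coeff_var_def)

lemma coeff_env_poly: "Polynomial.coeff (env_poly e k n) i = (if i \<le> n then e (10 + k + 3 * i) else 0)"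
  by (simp add: env_poly_def coeff_sum coeff_monom)

lemma term_value_pderiv_term: "term_value e (pderiv_term n j) = poly (pderiv (env_poly e 0 n)) (e j)"
proof -
  have "(\<Sum>i\<le>n. Polynomial.monom ((1 + of_nat i) * (if i < n then e (10 + 3 * Suc i) else 0)) i) =
      pderiv (env_poly e 0 n)"
    by (rule poly_eqI) (simp add: coeff_sum coeff_monom coeff_pderiv coeff_env_poly Suc_le_eq)
  then show ?thesis
    unfolding pderiv_term_def term_value_poly_term
    by (simp add: term_value_nat_term coeff_var_def if_distrib[of "term_value e"] cong: if_cong)
qed

lemma term_vars_value_term: "term_vars (value_term k n j) \<subseteq> {j} \<union> {10..<11 + k + 3 * n}"
  unfolding value_term_def
  by (rule order_trans[OF term_vars_poly_term]) (auto simp: coeff_var_def)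

lemma term_vars_pderiv_term: "term_vars (pderiv_term n j) \<subseteq> {j} \<union> {10..<11 + 3 * n}"
  unfolding pderiv_term_def
  by (rule order_trans[OF term_vars_poly_term])
    (auto simp: coeff_var_def term_vars_nat_term split: if_splits)

lemma env_poly_upd: "j < 10 \<Longrightarrow> env_poly (e(j := a)) k n = env_poly e k n"
  by (auto simp: env_poly_def intro!: sum.cong)

text \<open>Inverses are not in the language of rings; variables 4 to 6 hold them, characterised by
  products equal to 1.\<close>

definition member_formula :: "nat \<Rightarrow> nat \<Rightarrow> ring_formula" where
  "member_formula n j = Exists 1 (Exists 2 (Exists 3 (Exists 4 (Exists 5 (Exists 6
     (And (Eq (Times (Var 4) (value_term 0 n 1)) One)
     (And (Eq (Times (Var 5) (value_term 0 n 2)) One)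
     (And (Eq (Times (Var 6) (value_term 0 n 3)) One)
       (Eq (Var j) (Plus (Plus (Var 4) (Var 5)) (Minus (Var 6))))))))))))"

text \<open>Variables 1 to 6 are bound, whence the restriction on \<open>j\<close>. Without zeros of
  \<open>f\<close>, the inverses required by the formula exist for all arguments.\<close>

lemma satisfies_member_formula:
  fixes e :: "nat \<Rightarrow> 'a::field"
  assumes "j = 0 \<or> 6 < j" "\<And>x. poly (env_poly e 0 n) x \<noteq> 0"
  shows "satisfies e (member_formula n j) \<longleftrightarrow>
    (\<exists>x y z. e j = inverse (poly (env_poly e 0 n) x) + inverse (poly (env_poly e 0 n) y) -
       inverse (poly (env_poly e 0 n) z))"
proof -
  have inv: "a * poly (env_poly e 0 n) x = 1 \<longleftrightarrow> a = inverse (poly (env_poly e 0 n) x)" for a x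
    using assms(2)[of x] by (auto simp: field_simps)
  have "j \<noteq> 1" "j \<noteq> 2" "j \<noteq> 3" "j \<noteq> 4" "j \<noteq> 5" "j \<noteq> 6"
    using assms(1) by auto
  then show ?thesis
    by (simp add: member_formula_def term_value_value_term env_poly_upd inv)
qed

lemma free_vars_member_formula: "free_vars (member_formula n j) \<subseteq> {j} \<union> {10..<11 + 3 * n}"
  using term_vars_value_term[of 0 n 1] term_vars_value_term[of 0 n 2] term_vars_value_term[of 0 n 3]
  unfolding member_formula_def by auto

text \<open>One interval holds all indices \<open>10 + k + 3 * i\<close> with k \<le> 2 and i \<le>
  n + N, enough for \<open>f\<close> with formal degree \<open>n\<close> and \<open>A\<close>,
  \<open>B\<close> with formal degree \<open>N\<close>. Products are copied into variable 9 because
  \<open>member_formula\<close> speaks about a variable.\<close>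

definition matrix_formula :: "nat \<Rightarrow> nat \<Rightarrow> ring_formula" where
  "matrix_formula n N =
     And (Eq (coeff_var 0 n) One)
    (And (Forall 1 (Neg (Eq (value_term 0 n 1) Zero)))
    (And (Forall 1 (Eq (Plus (Times (value_term 1 N 1) (value_term 0 n 1))
                            (Times (value_term 2 N 1) (pderiv_term n 1))) One))
    (And (Conj (map (member_formula n) [10..<13 + 3 * (n + N)]))
    (And (Forall 7 (Forall 8 (Imp (And (member_formula n 7) (member_formula n 8))
           (Exists 9 (And (Eq (Var 9) (Times (Var 7) (Var 8))) (member_formula n 9))))))
         (member_formula n 0)))))"

lemma free_vars_matrix_formula: "free_vars (matrix_formula n N) \<subseteq> {0} \<union> {10..<13 + 3 * (n + N)}"
proof -
  let ?P = "{10..<13 + 3 * (n + N)}"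
  have m: "free_vars (member_formula n j) \<subseteq> {j} \<union> ?P" for j
    by (rule order_trans[OF free_vars_member_formula]) auto
  have t: "term_vars (value_term 0 n 1) \<subseteq> {1} \<union> ?P" "term_vars (value_term 1 N 1) \<subseteq> {1} \<union> ?P"
    "term_vars (value_term 2 N 1) \<subseteq> {1} \<union> ?P" "term_vars (pderiv_term n 1) \<subseteq> {1} \<union> ?P"
    by (rule order_trans[OF term_vars_value_term], force)+
      (rule order_trans[OF term_vars_pderiv_term], force)
  have "free_vars (Conj (map (member_formula n) [10..<13 + 3 * (n + N)])) \<subseteq> ?P"
    unfolding free_vars_simps using m by fastforce
  then show ?thesis
    using t m[of 0] m[of 7] m[of 8] m[of 9]
    unfolding matrix_formula_def by (auto simp: free_vars_simps coeff_var_def)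
qed

text \<open>If \<open>f\<close> has a zero, both sides fail at that conjunct; otherwise
  \<open>member_formula\<close> has its intended meaning.\<close>

lemma (in valued_field) satisfies_matrix_formula:
  "satisfies e (matrix_formula n N) \<longleftrightarrow>
     e (10 + 3 * n) = 1 \<and> (\<forall>x. poly (env_poly e 0 n) x \<noteq> 0) \<and>
     (\<forall>x. poly (env_poly e 1 N) x * poly (env_poly e 0 n) x +
          poly (env_poly e 2 N) x * poly (pderiv (env_poly e 0 n)) x = 1) \<and>
     (\<forall>j\<in>{10..<13 + 3 * (n + N)}. e j \<in> value_differences (env_poly e 0 n)) \<and>
     (\<forall>s\<in>value_differences (env_poly e 0 n). \<forall>t\<in>value_differences (env_poly e 0 n).
        s * t \<in> value_differences (env_poly e 0 n)) \<and>
     e 0 \<in> value_differences (env_poly e 0 n)"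
proof (cases "\<forall>x. poly (env_poly e 0 n) x \<noteq> 0")
  case True
  have member: "satisfies e' (member_formula n j) \<longleftrightarrow> e' j \<in> value_differences (env_poly e 0 n)"
    if "j = 0 \<or> 6 < j" "env_poly e' 0 n = env_poly e 0 n" for e' j
    using satisfies_member_formula[of j e' n] that True by (simp add: value_differences_def)
  show ?thesis
    unfolding matrix_formula_def
    by (auto simp: satisfies_Forall satisfies_Imp satisfies_Conj member env_poly_upd
        term_value_value_term term_value_pderiv_term coeff_var_def)
qed (auto simp: matrix_formula_def satisfies_Forall term_value_value_term env_poly_upd)

section \<open>Choice of the degrees and correctness of the formula\<close>

theorem corollary3p8:
  fixes v :: "'a::field \<Rightarrow> 'g::linordered_ab_group_add"
    and r :: "'a \<Rightarrow> 'k::field"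
  assumes "valuation v"
    and "henselian v"
    and "residue_map v r"
    and "pseudo_algebraically_closed TYPE('k)"
    and "\<not> separably_closed TYPE('k)"
  shows "valuation_definable v"
proof -
  interpret residue_valued_field v r
    by unfold_locales (fact assms)+
  obtain f0 :: "'k poly" where f0: "Factorial_Ring.irreducible f0" "lead_coeff f0 = 1"
    "pderiv f0 \<noteq> 0" "\<And>c. poly f0 c \<noteq> 0"
    using not_separably_closed_polynomial[OF assms(5)] by blast
  obtain f where f: "integral_poly f" "map_poly r f = f0"
    "Polynomial.degree f = Polynomial.degree f0" "lead_coeff f = 1"
    using ex_integral_lift[of f0] f0(2) by blast
  obtain A B where AB: "integral_poly A" "integral_poly B" "A * f + B * pderiv f = 1"
    using ex_integral_bezout[OF f(1)] f f0 by metis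
  have S: "value_differences f = \<O>"
    using value_differences_eq_ring[OF assms(2) f(1,4)] f(2) f0(4)
      PAC_value_differences[OF assms(4) f0(3,4)] by simp
  define n where "n = Polynomial.degree f"
  define N where "N = max (Polynomial.degree A) (Polynomial.degree B)"
  let ?params = "[10..<13 + 3 * (n + N)]"
  define \<phi> where "\<phi> = Exists_list ?params (matrix_formula n N)"
  have "free_vars \<phi> \<subseteq> {0}"
    unfolding \<phi>_def free_vars_simps using free_vars_matrix_formula[of n N] by auto
  moreover have "e 0 \<in> \<O> \<longleftrightarrow> satisfies e \<phi>" for e
  proof
    assume e: "e 0 \<in> \<O>"
    \<comment> \<open>As 10 leaves remainder 1 modulo 3, the remainders 1, 2, 0 select
      \<open>f\<close>, \<open>A\<close>, \<open>B\<close>. Surplus variables receive coefficients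
      past the degree, which are 0.\<close>
    define e' where "e' j = (if j \<in> set ?params then
      Polynomial.coeff (if j mod 3 = 1 then f else if j mod 3 = 2 then A else B) ((j - 10) div 3) else e j)" for j
    have e'_var: "e' (10 + k + 3 * i) = Polynomial.coeff (if k = 0 then f else if k = 1 then A else B) i"
      if "i \<le> n + N" "k \<le> 2" for i k
    proof -
      have "(10 + k + 3 * i) mod 3 = (k + 1) mod 3" "(10 + k + 3 * i - 10) div 3 = i"
        using that(2) by presburger+
      moreover have "k = 0 \<or> k = 1 \<or> k = 2" using that(2) by auto
      ultimately show ?thesis using that unfolding e'_def by auto
    qed
    have f': "env_poly e' 0 n = f"
      using e'_var[where k = 0] by (intro poly_eqI) (simp add: coeff_env_poly n_def coeff_eq_0)
    have A': "env_poly e' 1 N = A"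
      using e'_var[where k = 1] by (intro poly_eqI) (simp add: coeff_env_poly N_def coeff_eq_0)
    have B': "env_poly e' 2 N = B"
      using e'_var[where k = 2] by (intro poly_eqI) (simp add: coeff_env_poly N_def coeff_eq_0)
    have "e' (10 + 3 * n) = Polynomial.coeff (env_poly e' 0 n) n"
      by (simp add: coeff_env_poly)
    also have "\<dots> = 1" unfolding f' using f(4) by (simp add: n_def)
    finally have lead: "e' (10 + 3 * n) = 1" .
    have "poly f x \<noteq> 0" for x
      using no_residue_root_value(1)[OF f(1,4)] f(2) f0(4) by simp
    moreover have "poly A x * poly f x + poly B x * poly (pderiv f) x = 1" for x
      using arg_cong[OF AB(3), of "\<lambda>p. poly p x"] by simp
    moreover have "e' j \<in> \<O>" if "j \<in> {10..<13 + 3 * (n + N)}" for j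
      using that f(1) AB(1,2) by (auto simp: e'_def integral_poly_def)
    moreover have "e' 0 \<in> \<O>" using e by (simp add: e'_def)
    ultimately have "satisfies e' (matrix_formula n N)"
      unfolding satisfies_matrix_formula f' A' B' S using lead ring_closed(5) by blast
    moreover have "\<forall>j. j \<notin> set ?params \<longrightarrow> e' j = e j" by (simp add: e'_def)
    ultimately show "satisfies e \<phi>" unfolding \<phi>_def satisfies_Exists_list by blast
  next
    assume "satisfies e \<phi>"
    then obtain e' where e': "\<forall>j. j \<notin> set ?params \<longrightarrow> e' j = e j" "satisfies e' (matrix_formula n N)"
      unfolding \<phi>_def satisfies_Exists_list by blast
    \<comment> \<open>The polynomials encoded by \<open>e'\<close> need not be the chosen ones; the
      conjuncts alone supply the hypotheses of \<open>value_differences_subset_ring\<close>.\<close>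
    note sat = e'(2)[unfolded satisfies_matrix_formula]
    let ?f = "env_poly e' 0 n"
    have coeff: "Polynomial.coeff (env_poly e' k m) i \<in> value_differences ?f \<union> {0}"
      if "k \<le> 2" "m \<le> n + N" for k m i
      using sat that unfolding coeff_env_poly by auto
    \<comment> \<open>The coefficient of index \<open>n\<close> is required to be 1, so the formal
      degree is the actual one.\<close>
    have "Polynomial.degree ?f = n"
      using sat by (intro antisym degree_le le_degree) (auto simp: coeff_env_poly)
    then have "lead_coeff ?f = 1" using sat by (simp add: coeff_env_poly)
    then have "value_differences ?f \<subseteq> \<O>"
      using sat coeff
      by (intro value_differences_subset_ring[OF assms(2), of ?f _ "env_poly e' 1 N" "env_poly e' 2 N"])
        auto
    then show "e 0 \<in> \<O>" using sat e'(1) by auto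
  qed
  ultimately show ?thesis
    unfolding valuation_definable_def definable_without_parameters_def by blast
qed

end
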